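(* Let $\mathfrak{g}$ be a reductive Lie algebra endowed with an lcs structure $(\Omega,\vartheta)$ with $\vartheta\ne0$. Then $\mathfrak{h}=\ker\vartheta$ is a semisimple Lie algebra endowed with a contact form $\eta$, $\mathfrak{g}=\mathfrak{h}\oplus\mathbb{R}$ as Lie algebras, and $\Omega=d\eta-\vartheta\wedge\eta$ (with $\eta$ extended to $\mathfrak{g}$ by zero on the $\mathbb{R}$ summand). In particular $(\Omega,\vartheta)$ is of the first kind.
   Context: Lie algebras are real and finite-dimensional; $d$ is the Chevalley–Eilenberg differential. An lcs structure on a Lie algebra $\mathfrak{g}$ of dimension $2n\ge4$ is a pair $(\Omega,\vartheta)\in\Lambda^2\mathfrak{g}^*\times\mathfrak{g}^*$ with $\Omega^n\ne0$, $d\vartheta=0$, $d\Omega=\vartheta\wedge\Omega$. It is of the first kind if there is $X\in\mathfrak{g}$ with $L_X\Omega=0$ and $\vartheta(X)\neq0$, where $L_X=\imath_Xd+d\imath_X$. A contact form on a $(2n-1)$-dimensional Lie algebra $\mathfrak{h}$ is $\eta\in\mathfrak{h}^*$ with $\eta\wedge(d\eta)^{n-1}\ne0$. *)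

theory Defs
  imports Complex_Main "HOL-Library.Function_Algebras"
begin

text \<open>
  Finite-dimensional real Lie algebras, as subspaces of an ambient real vector space, so that
  ideals and kernels are Lie algebras in the same sense.
\<close>

locale lie_algebra =
  fixes g :: "'a::real_vector set" and br :: "'a \<Rightarrow> 'a \<Rightarrow> 'a"
  assumes subspace: "subspace g"
    and finite_dim: "\<exists>B. finite B \<and> span B = g"
    and closed: "x \<in> g \<Longrightarrow> y \<in> g \<Longrightarrow> br x y \<in> g"
    and add_left: "x \<in> g \<Longrightarrow> y \<in> g \<Longrightarrow> z \<in> g \<Longrightarrow> br (x + y) z = br x z + br y z"
    and add_right: "x \<in> g \<Longrightarrow> y \<in> g \<Longrightarrow> z \<in> g \<Longrightarrow> br x (y + z) = br x y + br x z"
    and scale_left: "x \<in> g \<Longrightarrow> y \<in> g \<Longrightarrow> br (c *\<^sub>R x) y = c *\<^sub>R br x y"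
    and scale_right: "x \<in> g \<Longrightarrow> y \<in> g \<Longrightarrow> br x (c *\<^sub>R y) = c *\<^sub>R br x y"
    and alternating: "x \<in> g \<Longrightarrow> br x x = 0"
    and jacobi: "x \<in> g \<Longrightarrow> y \<in> g \<Longrightarrow> z \<in> g \<Longrightarrow>
      br x (br y z) + br y (br z x) + br z (br x y) = 0"

definition lie_ideal :: "'a::real_vector set \<Rightarrow> ('a \<Rightarrow> 'a \<Rightarrow> 'a) \<Rightarrow> 'a set \<Rightarrow> bool" where
  "lie_ideal g br a \<longleftrightarrow> subspace a \<and> a \<subseteq> g \<and> (\<forall>x\<in>g. \<forall>y\<in>a. br x y \<in> a)"

text \<open>
  Internal direct sum of Lie algebras. The two summands commute, because the bracket of the
  ideals \<open>a\<close> and \<open>b\<close> lies in \<open>a \<inter> b\<close>.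
\<close>

definition lie_direct_sum ::
  "'a::real_vector set \<Rightarrow> ('a \<Rightarrow> 'a \<Rightarrow> 'a) \<Rightarrow> 'a set \<Rightarrow> 'a set \<Rightarrow> bool" where
  "lie_direct_sum g br a b \<longleftrightarrow>
     lie_ideal g br a \<and> lie_ideal g br b \<and> a \<inter> b = {0} \<and> {x + y | x y. x \<in> a \<and> y \<in> b} = g"

text \<open>Reductive: the adjoint representation is completely reducible.\<close>

definition reductive :: "'a::real_vector set \<Rightarrow> ('a \<Rightarrow> 'a \<Rightarrow> 'a) \<Rightarrow> bool" where
  "reductive g br \<longleftrightarrow> lie_algebra g br \<and>
     (\<forall>a. lie_ideal g br a \<longrightarrow> (\<exists>b. lie_direct_sum g br a b))"

definition derived_algebra :: "('a::real_vector \<Rightarrow> 'a \<Rightarrow> 'a) \<Rightarrow> 'a set \<Rightarrow> 'a set" where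
  "derived_algebra br a = span {br x y | x y. x \<in> a \<and> y \<in> a}"

definition lie_solvable :: "('a::real_vector \<Rightarrow> 'a \<Rightarrow> 'a) \<Rightarrow> 'a set \<Rightarrow> bool" where
  "lie_solvable br a \<longleftrightarrow> (\<exists>k. (derived_algebra br ^^ k) a = {0})"

definition semisimple :: "'a::real_vector set \<Rightarrow> ('a \<Rightarrow> 'a \<Rightarrow> 'a) \<Rightarrow> bool" where
  "semisimple g br \<longleftrightarrow> lie_algebra g br \<and>
     (\<forall>a. lie_ideal g br a \<longrightarrow> lie_solvable br a \<longrightarrow> a = {0})"

text \<open>
  A form is a real function on finite sequences of vectors. A form of degree \<open>k\<close> on \<open>g\<close> is
  multilinear and alternating on sequences of length \<open>k\<close> in \<open>g\<close>, and zero on every other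
  sequence; thus equality of functions is equality of forms, and the degree need not be passed
  to the operations below.
\<close>

type_synonym 'a form = "'a list \<Rightarrow> real"

definition forms :: "'a::real_vector set \<Rightarrow> nat \<Rightarrow> 'a form set" where
  "forms g k = {\<omega>.
     (\<forall>vs. \<not> (length vs = k \<and> set vs \<subseteq> g) \<longrightarrow> \<omega> vs = 0) \<and>
     (\<forall>us ws x y a b. length us + length ws + 1 = k \<longrightarrow> set us \<subseteq> g \<longrightarrow> set ws \<subseteq> g \<longrightarrow>
        x \<in> g \<longrightarrow> y \<in> g \<longrightarrow>
        \<omega> (us @ (a *\<^sub>R x + b *\<^sub>R y) # ws) = a * \<omega> (us @ x # ws) + b * \<omega> (us @ y # ws)) \<and>
     (\<forall>vs. \<not> distinct vs \<longrightarrow> \<omega> vs = 0)}"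

text \<open>
  The wedge product as a signed sum over shuffles, without further normalisation (so that
  \<open>(\<alpha> \<and> \<beta>)(x, y) = \<alpha>(x) \<beta>(y) - \<alpha>(y) \<beta>(x)\<close> in degree one). The set \<open>S\<close> holds the positions
  of the arguments of \<open>\<alpha>\<close>, and the exponent counts the inversions of the shuffle. For \<open>\<alpha>\<close> of
  degree \<open>p\<close> only the sets \<open>S\<close> of cardinality \<open>p\<close> contribute.
\<close>

definition wedge :: "'a form \<Rightarrow> 'a form \<Rightarrow> 'a form" where
  "wedge \<alpha> \<beta> vs = (\<Sum>S\<in>Pow {..<length vs}.
     (- 1) ^ card {(i, j). i \<in> S \<and> j < i \<and> j \<notin> S} * \<alpha> (nths vs S) * \<beta> (nths vs (- S)))"

primrec wedge_power :: "'a form \<Rightarrow> nat \<Rightarrow> 'a form" where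
  "wedge_power \<omega> 0 = (\<lambda>vs. if vs = [] then 1 else 0)"
| "wedge_power \<omega> (Suc n) = wedge \<omega> (wedge_power \<omega> n)"

text \<open>
  The Chevalley--Eilenberg differential (trivial coefficients),
  \<open>d\<omega>(v\<^sub>0, \<dots>, v\<^sub>k) = \<Sum>\<^sub>i\<^sub><\<^sub>j (-1)\<^sup>i\<^sup>+\<^sup>j \<omega>([v\<^sub>i, v\<^sub>j], v\<^sub>0, \<dots>, v\<^sub>k)\<close> with \<open>v\<^sub>i\<close> and \<open>v\<^sub>j\<close> omitted from the
  tail; in degree one, \<open>d\<eta>(x, y) = - \<eta>([x, y])\<close>.
\<close>

definition ce_d ::
  "'a::real_vector set \<Rightarrow> ('a \<Rightarrow> 'a \<Rightarrow> 'a) \<Rightarrow> 'a form \<Rightarrow> 'a form" where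
  "ce_d g br \<omega> vs = (if set vs \<subseteq> g then
     (\<Sum>j<length vs. \<Sum>i<j. (- 1) ^ (i + j) * \<omega> (br (vs ! i) (vs ! j) # nths vs (- {i, j})))
     else 0)"

definition interior_product :: "'a \<Rightarrow> 'a form \<Rightarrow> 'a form" where
  "interior_product x \<omega> vs = \<omega> (x # vs)"

definition lie_derivative ::
  "'a::real_vector set \<Rightarrow> ('a \<Rightarrow> 'a \<Rightarrow> 'a) \<Rightarrow> 'a \<Rightarrow> 'a form \<Rightarrow> 'a form" where
  "lie_derivative g br x \<omega> = interior_product x (ce_d g br \<omega>) + ce_d g br (interior_product x \<omega>)"

definition form_kernel :: "'a::real_vector set \<Rightarrow> 'a form \<Rightarrow> 'a set" where
  "form_kernel g \<theta> = {x \<in> g. \<theta> [x] = 0}"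

definition lcs_structure ::
  "'a::real_vector set \<Rightarrow> ('a \<Rightarrow> 'a \<Rightarrow> 'a) \<Rightarrow> nat \<Rightarrow> 'a form \<Rightarrow> 'a form \<Rightarrow> bool" where
  "lcs_structure g br n \<Omega> \<theta> \<longleftrightarrow> lie_algebra g br \<and> 2 * n \<ge> 4 \<and> dim g = 2 * n \<and>
     \<Omega> \<in> forms g 2 \<and> \<theta> \<in> forms g 1 \<and>
     wedge_power \<Omega> n \<noteq> 0 \<and> ce_d g br \<theta> = 0 \<and> ce_d g br \<Omega> = wedge \<theta> \<Omega>"

definition lcs_first_kind ::
  "'a::real_vector set \<Rightarrow> ('a \<Rightarrow> 'a \<Rightarrow> 'a) \<Rightarrow> nat \<Rightarrow> 'a form \<Rightarrow> 'a form \<Rightarrow> bool" where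
  "lcs_first_kind g br n \<Omega> \<theta> \<longleftrightarrow> lcs_structure g br n \<Omega> \<theta> \<and>
     (\<exists>x\<in>g. lie_derivative g br x \<Omega> = 0 \<and> \<theta> [x] \<noteq> 0)"

definition contact_form ::
  "'a::real_vector set \<Rightarrow> ('a \<Rightarrow> 'a \<Rightarrow> 'a) \<Rightarrow> nat \<Rightarrow> 'a form \<Rightarrow> bool" where
  "contact_form h br n \<eta> \<longleftrightarrow> lie_algebra h br \<and> n \<ge> 1 \<and> dim h = 2 * n - 1 \<and>
     \<eta> \<in> forms h 1 \<and> wedge \<eta> (wedge_power (ce_d h br \<eta>) (n - 1)) \<noteq> 0"

text \<open>
  \<open>\<eta>'\<close> is the extension by zero on \<open>r\<close> of the one-form \<open>\<eta>\<close> on \<open>h\<close>; it is unique when \<open>g\<close> is the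
  sum of \<open>h\<close> and \<open>r\<close>.
\<close>

definition extends_by_zero ::
  "'a::real_vector set \<Rightarrow> 'a set \<Rightarrow> 'a set \<Rightarrow> 'a form \<Rightarrow> 'a form \<Rightarrow> bool" where
  "extends_by_zero g h r \<eta> \<eta>' \<longleftrightarrow> \<eta>' \<in> forms g 1 \<and>
     (\<forall>x\<in>h. \<eta>' [x] = \<eta> [x]) \<and> (\<forall>x\<in>r. \<eta>' [x] = 0)"

end

theory Submission
  imports Defs
begin

text \<open>
  The kernel of \<open>\<theta>\<close> contains \<open>[g, g]\<close>, so it is an ideal, and its complement is spanned by a
  central \<open>T\<close> with \<open>\<theta>(T) = 1\<close>. Since \<open>T\<close> is central, \<open>L\<^sub>T \<Omega> = 0\<close>, and contracting
  \<open>d\<Omega> = \<theta> \<and> \<Omega>\<close> with \<open>T\<close> yields \<open>\<Omega> = d\<eta> - \<theta> \<and> \<eta>\<close> for \<open>\<eta> = - \<iota>\<^sub>T \<Omega>\<close>. On the kernel,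
  \<open>\<iota>\<^sub>T \<Omega>\<^sup>n = - n \<eta> \<and> (d\<eta>)\<^sup>n\<^sup>-\<^sup>1\<close>, hence \<open>\<eta>\<close> is contact.

  For semisimplicity it suffices to exclude abelian ideals \<open>a \<noteq> 0\<close> of \<open>g\<close> inside the kernel. Such an
  ideal is central and meets \<open>[g, g]\<close> trivially, and \<open>\<iota>\<^sub>z \<Omega>\<close> is a multiple of \<open>\<theta>\<close> for
  \<open>z \<in> a\<close>. But \<open>g\<close> is unimodular, and contracting the equation \<open>d\<Omega> = \<theta> \<and> \<Omega>\<close> with the
  inverse of \<open>\<Omega>\<close> shows that \<open>- (2 n - 2) \<theta> = \<iota>\<^sub>w \<Omega>\<close> for \<open>w = \<Sum> [e\<^sub>i, e\<^sub>i\<^sup>*] \<in> [g, g]\<close>, where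
  \<open>\<Omega>(e\<^sub>i, e\<^sub>j\<^sup>*) = \<delta>\<^sub>i\<^sub>j\<close>. By nondegeneracy \<open>z\<close> is a multiple of \<open>w\<close>, so \<open>z = 0\<close>.
\<close>

subsection \<open>Forms on sequences of vectors\<close>

abbreviation ip where "ip \<equiv> interior_product"

text \<open>The conditions behind membership in \<open>forms\<close> are stated separately so that
  each can be carried through \<open>wedge\<close> and \<open>wedge_power\<close> on its
  own.\<close>

definition homogeneous :: "nat \<Rightarrow> 'a form \<Rightarrow> bool" where
  "homogeneous p \<alpha> \<longleftrightarrow> (\<forall>vs. length vs \<noteq> p \<longrightarrow> \<alpha> vs = 0)"

text \<open>The neighbour swap suits induction on the prefix \<open>us\<close>. It may range over
  all vectors because a form vanishes outside its carrier.\<close>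

definition skew :: "'a form \<Rightarrow> bool" where
  "skew \<alpha> \<longleftrightarrow> (\<forall>us x y vs. \<alpha> (us @ x # y # vs) = - \<alpha> (us @ y # x # vs))"

text \<open>No length is prescribed: in the wrong degree both sides vanish, see
  \<open>forms_multilinear_on\<close>.\<close>

definition multilinear_on :: "'a::real_vector set \<Rightarrow> 'a form \<Rightarrow> bool" where
  "multilinear_on g \<alpha> \<longleftrightarrow> (\<forall>us ws x y a b.
     set us \<subseteq> g \<longrightarrow> set ws \<subseteq> g \<longrightarrow> x \<in> g \<longrightarrow> y \<in> g \<longrightarrow>
     \<alpha> (us @ (a *\<^sub>R x + b *\<^sub>R y) # ws) = a * \<alpha> (us @ x # ws) + b * \<alpha> (us @ y # ws))"

definition supported_on :: "'a set \<Rightarrow> 'a form \<Rightarrow> bool" where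
  "supported_on g \<alpha> \<longleftrightarrow> (\<forall>vs. \<not> set vs \<subseteq> g \<longrightarrow> \<alpha> vs = 0)"

lemma multilinear_onD:
  "multilinear_on g \<alpha> \<Longrightarrow> set us \<subseteq> g \<Longrightarrow> set ws \<subseteq> g \<Longrightarrow> x \<in> g \<Longrightarrow> y \<in> g \<Longrightarrow>
     \<alpha> (us @ (a *\<^sub>R x + b *\<^sub>R y) # ws) = a * \<alpha> (us @ x # ws) + b * \<alpha> (us @ y # ws)"
  by (simp add: multilinear_on_def)

lemma homogeneousD: "homogeneous p \<alpha> \<Longrightarrow> length vs \<noteq> p \<Longrightarrow> \<alpha> vs = 0"
  by (simp add: homogeneous_def)

lemma homogeneous_interior: "homogeneous (Suc p) \<alpha> \<Longrightarrow> homogeneous p (ip x \<alpha>)"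
  by (simp add: homogeneous_def interior_product_def)

lemma interior_homogeneous_0: "homogeneous 0 \<alpha> \<Longrightarrow> ip x \<alpha> = 0"
  by (simp add: homogeneous_def interior_product_def fun_eq_iff)

lemma skew_interior: "skew \<alpha> \<Longrightarrow> skew (ip x \<alpha>)"
  unfolding skew_def interior_product_def by (metis append_Cons)

lemma multilinear_interior: "multilinear_on g \<alpha> \<Longrightarrow> x \<in> g \<Longrightarrow> multilinear_on g (ip x \<alpha>)"
  unfolding multilinear_on_def interior_product_def
  by (metis append_Cons insert_subset list.simps(15))

section \<open>The wedge product: contraction, graded commutativity, skewness,
  multilinearity\<close>

lemma wedge_Nil [simp]: "wedge \<alpha> \<beta> [] = \<alpha> [] * \<beta> []"
  by (simp add: wedge_def)

lemma wedge_zero [simp]: "wedge 0 \<beta> vs = 0" "wedge \<alpha> 0 vs = 0"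
  by (simp_all add: wedge_def)

lemma wedge_linear_left: "wedge (\<lambda>vs. a * \<alpha> vs + b * \<alpha>' vs) \<beta> vs = a * wedge \<alpha> \<beta> vs + b * wedge \<alpha>' \<beta> vs"
  by (simp add: wedge_def sum_distrib_left sum.distrib algebra_simps)

lemma wedge_linear_right: "wedge \<alpha> (\<lambda>vs. a * \<beta> vs + b * \<beta>' vs) vs = a * wedge \<alpha> \<beta> vs + b * wedge \<alpha> \<beta>' vs"
  by (simp add: wedge_def sum_distrib_left sum.distrib algebra_simps)

lemma wedge_scale_right: "wedge \<alpha> (\<lambda>vs. a * \<beta> vs) vs = a * wedge \<alpha> \<beta> vs"
  using wedge_linear_right[of \<alpha> a \<beta> 0 0 vs] by simp

lemma wedge_minus_left: "wedge (\<lambda>vs. - \<alpha> vs) \<beta> vs = - wedge \<alpha> \<beta> vs"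
  using wedge_linear_left[of "-1" \<alpha> 0 0 \<beta> vs] by simp

text \<open>Lets a form on a subalgebra stand in for the restriction of a form on \<open>g\<close>:
  as functions the two differ outside the subalgebra, but only lists of entries of \<open>vs\<close>
  matter.\<close>

lemma wedge_cong:
  assumes "\<And>us. set us \<subseteq> set vs \<Longrightarrow> \<alpha> us = \<alpha>' us" "\<And>us. set us \<subseteq> set vs \<Longrightarrow> \<beta> us = \<beta>' us"
  shows "wedge \<alpha> \<beta> vs = wedge \<alpha>' \<beta>' vs"
  unfolding wedge_def using assms by (simp add: set_nths_subset)

lemma wedge_power_cong:
  "(\<And>us. set us \<subseteq> set vs \<Longrightarrow> \<alpha> us = \<alpha>' us) \<Longrightarrow> wedge_power \<alpha> n vs = wedge_power \<alpha>' n vs"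
proof (induction n arbitrary: vs)
  case (Suc n)
  show ?case unfolding wedge_power.simps
    by (rule wedge_cong) (auto intro!: Suc.prems Suc.IH)
qed simp

lemma length_nths_Compl: "length (nths vs S) + length (nths vs (- S)) = length vs"
proof (induction vs arbitrary: S)
  case (Cons v vs)
  have "{j. Suc j \<notin> S} = - {j. Suc j \<in> S}" by auto
  with Cons[of "{j. Suc j \<in> S}"] show ?case by (simp add: nths_Cons)
qed simp

lemma set_nths_Un_Compl: "set (nths vs S) \<union> set (nths vs (- S)) = set vs"
  unfolding set_nths set_conv_nth[of vs] by blast

lemma homogeneous_wedge:
  assumes "homogeneous p \<alpha>" "homogeneous q \<beta>"
  shows "homogeneous (p + q) (wedge \<alpha> \<beta>)"
  unfolding homogeneous_def
proof (intro allI impI)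
  fix vs :: "'a list" assume "length vs \<noteq> p + q"
  then have "length (nths vs S) \<noteq> p \<or> length (nths vs (- S)) \<noteq> q" for S
    using length_nths_Compl[of vs S] by auto
  then have "\<alpha> (nths vs S) * \<beta> (nths vs (- S)) = 0" for S
    using homogeneousD[OF assms(1), of "nths vs S"] homogeneousD[OF assms(2), of "nths vs (- S)"]
    by fastforce
  then show "wedge \<alpha> \<beta> vs = 0" unfolding wedge_def mult.assoc by (simp only: mult_zero_right sum.neutral_const)
qed

lemma supported_on_wedge:
  assumes "supported_on g \<alpha>" "supported_on g \<beta>"
  shows "supported_on g (wedge \<alpha> \<beta>)"
  unfolding supported_on_def
proof (intro allI impI)
  fix vs assume "\<not> set vs \<subseteq> g"
  then have "\<alpha> (nths vs S) * \<beta> (nths vs (- S)) = 0" for S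
    using assms set_nths_Un_Compl[of vs S] unfolding supported_on_def
    by (metis Un_least mult_eq_0_iff)
  then show "wedge \<alpha> \<beta> vs = 0" unfolding wedge_def mult.assoc by (simp only: mult_zero_right sum.neutral_const)
qed

text \<open>The two families are the shuffles in which the head of a list, at position 0, goes to
  the second factor and to the first factor.\<close>

lemma Pow_lessThan_Suc_split:
  "Pow {..<Suc m} = (\<lambda>S. Suc ` S) ` Pow {..<m} \<union> (\<lambda>S. insert 0 (Suc ` S)) ` Pow {..<m}"
proof -
  have "Pow {..<Suc m} = Pow (insert 0 (Suc ` {..<m}))"
    by (simp add: lessThan_Suc_eq_insert_0)
  also have "\<dots> = Pow (Suc ` {..<m}) \<union> insert 0 ` Pow (Suc ` {..<m})"
    by (rule Pow_insert)
  also have "Pow (Suc ` {..<m}) = (\<lambda>S. Suc ` S) ` Pow {..<m}"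
    by (simp add: image_Pow_surj)
  finally show ?thesis by (simp add: image_image)
qed

text \<open>Contraction is an antiderivation: the head goes to \<open>\<alpha>\<close> or to
  \<open>\<beta>\<close>, and in the second case it must pass all \<open>p\<close> arguments of
  \<open>\<alpha>\<close>. This recursion on the argument list drives the inductions below.\<close>

lemma wedge_Cons:
  assumes \<alpha>: "homogeneous p \<alpha>"
  shows "wedge \<alpha> \<beta> (x # vs) = wedge (ip x \<alpha>) \<beta> vs + (- 1) ^ p * wedge \<alpha> (ip x \<beta>) vs"
proof -
  define inv where "inv S = {(i, j). i \<in> S \<and> j < i \<and> j \<notin> S}" for S :: "nat set"
  define t where "t S = (- 1) ^ card (inv S) * \<alpha> (nths (x # vs) S) * \<beta> (nths (x # vs) (- S))" for S
  have fin: "finite (inv S)" if "finite S" for S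
  proof (rule finite_subset)
    show "inv S \<subseteq> Sigma S (\<lambda>i. {..<i})" by (auto simp: inv_def)
  qed (use that in auto)
  \<comment> \<open>Position 0 has nothing below it and belongs to the set itself, so it takes part
    in no inversion.\<close>
  have c1: "card (inv (insert 0 (Suc ` S))) = card (inv S)" for S
  proof -
    have "inv (insert 0 (Suc ` S)) = map_prod Suc Suc ` inv S"
    proof (rule set_eqI)
      fix z :: "nat \<times> nat" obtain i j where z: "z = (i, j)" by force
      show "z \<in> inv (insert 0 (Suc ` S)) \<longleftrightarrow> z \<in> map_prod Suc Suc ` inv S"
        by (cases i; cases j) (auto simp: z inv_def image_iff)
    qed
    then show ?thesis by (simp add: card_image prod.inj_map inj_on_subset[OF prod.inj_map])
  qed
  \<comment> \<open>Position 0 now lies outside the set, and each member of the set forms one new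
    inversion with it.\<close>
  have c2: "card (inv (Suc ` S)) = card (inv S) + card S" if "finite S" for S
  proof -
    have "inv (Suc ` S) = map_prod Suc Suc ` inv S \<union> (\<lambda>i. (Suc i, 0)) ` S"
    proof (rule set_eqI)
      fix z :: "nat \<times> nat" obtain i j where z: "z = (i, j)" by force
      show "z \<in> inv (Suc ` S) \<longleftrightarrow> z \<in> map_prod Suc Suc ` inv S \<union> (\<lambda>i. (Suc i, 0)) ` S"
        by (cases i; cases j) (auto simp: z inv_def image_iff)
    qed
    moreover have "map_prod Suc Suc ` inv S \<inter> (\<lambda>i. (Suc i, 0)) ` S = {}" by auto
    moreover have "card (map_prod Suc Suc ` inv S) = card (inv S)"
      by (simp add: card_image prod.inj_map inj_on_subset[OF prod.inj_map])
    moreover have "card ((\<lambda>i. (Suc i, 0::nat)) ` S) = card S"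
      by (simp add: card_image inj_on_def)
    ultimately show ?thesis using fin[OF that] that by (simp add: card_Un_disjoint)
  qed
  have t1: "t (insert 0 (Suc ` S)) = (- 1) ^ card (inv S) * ip x \<alpha> (nths vs S) * \<beta> (nths vs (- S))" for S
  proof -
    have "{j. Suc j \<in> insert 0 (Suc ` S)} = S" "{j. Suc j \<in> - insert 0 (Suc ` S)} = - S" by auto
    then show ?thesis unfolding t_def c1 nths_Cons by (simp add: interior_product_def)
  qed
  \<comment> \<open>The extra sign depends on \<open>card S\<close>, but only sets with
    \<open>card S = p\<close> give a nonzero term, so it is the constant
    \<open>(- 1) ^ p\<close>.\<close>
  have t2: "t (Suc ` S) = (- 1) ^ p * ((- 1) ^ card (inv S) * \<alpha> (nths vs S) * ip x \<beta> (nths vs (- S)))"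
    if S: "S \<subseteq> {..<length vs}" for S
  proof (cases "card S = p")
    case True
    have "finite S" using S finite_subset by blast
    moreover have "{j. Suc j \<in> Suc ` S} = S" "{j. Suc j \<in> - (Suc ` S)} = - S" by auto
    ultimately show ?thesis
      unfolding t_def nths_Cons by (auto simp add: interior_product_def c2 True power_add)
  next
    case False
    have "{i. i < length vs \<and> i \<in> S} = S" using S by auto
    then have "length (nths vs S) \<noteq> p" using False by (simp add: length_nths)
    moreover have "{j. Suc j \<in> Suc ` S} = S" by auto
    ultimately show ?thesis unfolding t_def nths_Cons
      using homogeneousD[OF \<alpha>] by auto
  qed
  have inj1: "inj_on (\<lambda>S. Suc ` S) (Pow {..<length vs})"
    by (auto simp: inj_on_def inj_image_eq_iff)
  have inj2: "inj_on (\<lambda>S. insert 0 (Suc ` S)) (Pow {..<length vs})"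
  proof (rule inj_onI)
    fix S S' assume "insert 0 (Suc ` S) = insert 0 (Suc ` S')"
    then have "Suc ` S = Suc ` S'" by (metis (no_types, lifting) Diff_insert_absorb imageE nat.distinct(1))
    then show "S = S'" by (simp add: inj_image_eq_iff)
  qed
  have "wedge \<alpha> \<beta> (x # vs) = (\<Sum>S\<in>Pow {..<Suc (length vs)}. t S)"
    by (simp add: wedge_def t_def inv_def)
  also have "\<dots> = (\<Sum>S\<in>(\<lambda>S. Suc ` S) ` Pow {..<length vs}. t S)
      + (\<Sum>S\<in>(\<lambda>S. insert 0 (Suc ` S)) ` Pow {..<length vs}. t S)"
    unfolding Pow_lessThan_Suc_split by (rule sum.union_disjoint) auto
  also have "\<dots> = (\<Sum>S\<in>Pow {..<length vs}. t (Suc ` S)) + (\<Sum>S\<in>Pow {..<length vs}. t (insert 0 (Suc ` S)))"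
    by (simp add: sum.reindex[OF inj1] sum.reindex[OF inj2])
  also have "\<dots> = (- 1) ^ p * wedge \<alpha> (ip x \<beta>) vs + wedge (ip x \<alpha>) \<beta> vs"
    by (simp add: t1 t2 wedge_def sum_distrib_left flip: inv_def)
  finally show ?thesis by simp
qed

\<comment> \<open>The factor 1 makes the right-hand side an instance of \<open>wedge_linear_right\<close>.\<close>
lemma interior_wedge:
  assumes "homogeneous p \<alpha>"
  shows "ip x (wedge \<alpha> \<beta>) = (\<lambda>vs. 1 * wedge (ip x \<alpha>) \<beta> vs + (- 1) ^ p * wedge \<alpha> (ip x \<beta>) vs)"
  by (simp add: fun_eq_iff wedge_Cons[OF assms] interior_product_def[of x "wedge \<alpha> \<beta>"])

text \<open>Expanding both sides by \<open>wedge_Cons\<close> leaves contractions of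
  \<open>\<alpha>\<close>, of \<open>\<beta>\<close> and of \<open>\<gamma>\<close>, and each kind
  agrees by the induction hypothesis on the shorter list; in degree 0 the contraction is zero. The
  third factor is there because wedge powers are nested to the right.\<close>

lemma wedge_left_commute:
  assumes "homogeneous p \<alpha>" "homogeneous q \<beta>"
  shows "wedge \<alpha> (wedge \<beta> \<gamma>) vs = (- 1) ^ (p * q) * wedge \<beta> (wedge \<alpha> \<gamma>) vs"
  using assms
proof (induction vs arbitrary: p q \<alpha> \<beta> \<gamma>)
  case Nil
  then show ?case
    by (cases "p = 0"; cases "q = 0") (auto simp: homogeneousD)
next
  case (Cons x vs)
  note \<alpha> = \<open>homogeneous p \<alpha>\<close> and \<beta> = \<open>homogeneous q \<beta>\<close>
  have 1: "(- 1) ^ q * (- 1) ^ (p * q) * wedge \<beta> (wedge (ip x \<alpha>) \<gamma>) vs = wedge (ip x \<alpha>) (wedge \<beta> \<gamma>) vs"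
  proof (cases p)
    case 0
    then show ?thesis using \<alpha>
      by (simp add: interior_homogeneous_0) (simp add: wedge_def)
  next
    case (Suc k)
    then show ?thesis
      using Cons.IH[OF homogeneous_interior \<beta>, of k \<alpha> x \<gamma>] \<alpha> by (simp add: power_add flip: power_mult_distrib mult.assoc)
  qed
  have 2: "(- 1) ^ (p * q) * wedge (ip x \<beta>) (wedge \<alpha> \<gamma>) vs = (- 1) ^ p * wedge \<alpha> (wedge (ip x \<beta>) \<gamma>) vs"
  proof (cases q)
    case 0
    then show ?thesis using \<beta>
      by (simp add: interior_homogeneous_0) (simp add: wedge_def)
  next
    case (Suc k)
    then show ?thesis
      using Cons.IH[OF \<alpha> homogeneous_interior, of k \<beta> x \<gamma>] \<beta> by (simp add: power_add)
  qed
  have 3: "wedge \<alpha> (wedge \<beta> (ip x \<gamma>)) vs = (- 1) ^ (p * q) * wedge \<beta> (wedge \<alpha> (ip x \<gamma>)) vs"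
    using Cons.IH[OF \<alpha> \<beta>] .
  show ?case
    unfolding wedge_Cons[OF \<alpha>] wedge_Cons[OF \<beta>] interior_wedge[OF \<alpha>] interior_wedge[OF \<beta>] wedge_linear_right
    using 1 2 3 by (simp add: algebra_simps)
qed

text \<open>Once the prefix is contracted away, the swap concerns the first two arguments. Terms
  with both arguments in one factor change sign by assumption; the two mixed terms carry opposite
  signs and are exchanged.\<close>

lemma skew_wedge:
  assumes "homogeneous p \<alpha>" "skew \<alpha>" "skew \<beta>"
  shows "skew (wedge \<alpha> \<beta>)"
proof -
  have "wedge \<alpha> \<beta> (us @ x # y # vs) = - wedge \<alpha> \<beta> (us @ y # x # vs)" for us x y vs
    using assms
  proof (induction us arbitrary: p \<alpha> \<beta>)
    case Nil
    have sw: "ip y (ip x \<alpha>) = (\<lambda>vs. - ip x (ip y \<alpha>) vs)" "ip y (ip x \<beta>) = (\<lambda>vs. - ip x (ip y \<beta>) vs)"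
      using Nil(2,3) unfolding skew_def fun_eq_iff interior_product_def by (metis append_Nil)+
    have w: "wedge (ip y (ip x \<alpha>)) \<beta> vs = - wedge (ip x (ip y \<alpha>)) \<beta> vs"
        "wedge \<alpha> (ip y (ip x \<beta>)) vs = - wedge \<alpha> (ip x (ip y \<beta>)) vs"
      unfolding sw using wedge_scale_right[of \<alpha> "- 1"] by (simp_all add: wedge_minus_left)
    show ?case
    proof (cases p)
      case 0
      then show ?thesis
        using Nil(1) w(2) by (simp add: wedge_Cons interior_homogeneous_0)
    next
      case (Suc k)
      then have "homogeneous k (ip z \<alpha>)" for z using Nil(1) by (simp add: homogeneous_interior)
      then show ?thesis
        using Nil(1) w Suc by (simp add: wedge_Cons[of "Suc k" \<alpha>] wedge_Cons[of k] algebra_simps)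
    qed
  next
    case (Cons u us)
    have "wedge (ip u \<alpha>) \<beta> (us @ x # y # vs) = - wedge (ip u \<alpha>) \<beta> (us @ y # x # vs)"
    proof (cases p)
      case (Suc k)
      then show ?thesis
        using Cons.prems by (intro Cons.IH[of k]) (simp_all add: homogeneous_interior skew_interior)
    qed (use Cons.prems in \<open>simp add: interior_homogeneous_0\<close>)
    moreover have "wedge \<alpha> (ip u \<beta>) (us @ x # y # vs) = - wedge \<alpha> (ip u \<beta>) (us @ y # x # vs)"
      using Cons.prems by (intro Cons.IH[of p]) (simp_all add: skew_interior)
    ultimately show ?case using Cons.prems(1) by (simp add: wedge_Cons)
  qed
  then show ?thesis unfolding skew_def by blast
qed

lemma multilinear_wedge:
  assumes "homogeneous p \<alpha>" "multilinear_on g \<alpha>" "multilinear_on g \<beta>"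
  shows "multilinear_on g (wedge \<alpha> \<beta>)"
proof -
  have "wedge \<alpha> \<beta> (us @ (a *\<^sub>R x + b *\<^sub>R y) # ws) = a * wedge \<alpha> \<beta> (us @ x # ws) + b * wedge \<alpha> \<beta> (us @ y # ws)"
    if "set us \<subseteq> g" "set ws \<subseteq> g" "x \<in> g" "y \<in> g" for us ws x y a b
    using assms that(1)
  proof (induction us arbitrary: p \<alpha> \<beta>)
    case Nil
    have "wedge (ip (a *\<^sub>R x + b *\<^sub>R y) \<alpha>) \<beta> ws = wedge (\<lambda>vs. a * ip x \<alpha> vs + b * ip y \<alpha> vs) \<beta> ws"
      "wedge \<alpha> (ip (a *\<^sub>R x + b *\<^sub>R y) \<beta>) ws = wedge \<alpha> (\<lambda>vs. a * ip x \<beta> vs + b * ip y \<beta> vs) ws"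
      unfolding interior_product_def
      using Nil that(2-) multilinear_onD[where us = "[]" and g = g]
      by (auto intro!: wedge_cong)
    then show ?case using Nil.prems(1)
      by (simp add: wedge_Cons wedge_linear_left wedge_linear_right algebra_simps)
  next
    case (Cons u us)
    have u: "multilinear_on g (ip u \<alpha>)" "multilinear_on g (ip u \<beta>)"
      using Cons.prems by (auto intro!: multilinear_interior)
    have "wedge (ip u \<alpha>) \<beta> (us @ (a *\<^sub>R x + b *\<^sub>R y) # ws) = a * wedge (ip u \<alpha>) \<beta> (us @ x # ws) + b * wedge (ip u \<alpha>) \<beta> (us @ y # ws)"
    proof (cases p)
      case (Suc k)
      then show ?thesis
        using Cons.prems by (intro Cons.IH[OF homogeneous_interior u(1)]) auto
    qed (use Cons.prems in \<open>simp add: interior_homogeneous_0\<close>)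
    moreover have "wedge \<alpha> (ip u \<beta>) (us @ (a *\<^sub>R x + b *\<^sub>R y) # ws) = a * wedge \<alpha> (ip u \<beta>) (us @ x # ws) + b * wedge \<alpha> (ip u \<beta>) (us @ y # ws)"
      using Cons.prems u by (intro Cons.IH) auto
    ultimately show ?case using Cons.prems(1) by (simp add: wedge_Cons algebra_simps)
  qed
  then show ?thesis by (simp add: multilinear_on_def)
qed

section \<open>Wedge powers and their contractions\<close>

lemma wedge_power_homogeneous: "homogeneous p \<omega> \<Longrightarrow> homogeneous (n * p) (wedge_power \<omega> n)"
  by (induction n) (auto simp: homogeneous_def[of 0] homogeneous_wedge)

lemma wedge_power_supported_on: "supported_on g \<omega> \<Longrightarrow> supported_on g (wedge_power \<omega> n)"
proof (induction n)
  case 0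
  show ?case by (simp add: supported_on_def)
qed (simp add: supported_on_wedge)

lemma wedge_power_skew: "homogeneous p \<omega> \<Longrightarrow> skew \<omega> \<Longrightarrow> skew (wedge_power \<omega> n)"
proof (induction n)
  case 0
  show ?case by (simp add: skew_def)
qed (simp add: skew_wedge)

lemma wedge_power_multilinear:
  "homogeneous p \<omega> \<Longrightarrow> multilinear_on g \<omega> \<Longrightarrow> multilinear_on g (wedge_power \<omega> n)"
proof (induction n)
  case 0
  show ?case by (simp add: multilinear_on_def)
qed (simp add: multilinear_wedge)

text \<open>The degree of \<open>\<omega>\<close> is even, so contraction obeys the Leibniz rule
  without signs and \<open>ip x \<omega>\<close> moves past each factor \<open>\<omega>\<close>; the
  \<open>Suc n\<close> terms coincide. This serves both the nondegeneracy of \<open>\<Omega>\<close>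
  and the contact condition.\<close>

lemma wedge_power_Suc_Cons:
  assumes "homogeneous 2 \<omega>"
  shows "wedge_power \<omega> (Suc n) (x # vs) = real (Suc n) * wedge (ip x \<omega>) (wedge_power \<omega> n) vs"
proof (induction n arbitrary: vs)
  case 0
  have "ip x (wedge_power \<omega> 0) = 0" by (simp add: fun_eq_iff interior_product_def)
  then show ?case using wedge_Cons[OF assms] by simp
next
  case (Suc n)
  have "ip x (wedge_power \<omega> (Suc n)) = (\<lambda>vs. real (Suc n) * wedge (ip x \<omega>) (wedge_power \<omega> n) vs)"
    using Suc unfolding interior_product_def[of x "wedge_power \<omega> (Suc n)"] by blast
  moreover have "wedge \<omega> (wedge (ip x \<omega>) (wedge_power \<omega> n)) vs = wedge (ip x \<omega>) (wedge_power \<omega> (Suc n)) vs"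
    using wedge_left_commute[OF assms, of 1 "ip x \<omega>"] homogeneous_interior[of 1 \<omega> x] assms
    by (simp add: numeral_2_eq_2)
  ultimately show ?case
    unfolding wedge_power.simps(2)[of \<omega> "Suc n"] wedge_Cons[OF assms]
    by (simp only: wedge_scale_right) (simp add: algebra_simps del: wedge_power.simps)
qed

section \<open>Evaluation of skew and multilinear forms on bases\<close>

lemma skew_move:
  assumes "skew \<omega>"
  shows "\<omega> (us @ x # ys @ zs) = (- 1) ^ length ys * \<omega> (us @ ys @ x # zs)"
proof (induction ys arbitrary: us)
  case (Cons y ys)
  have "\<omega> (us @ x # y # ys @ zs) = - \<omega> ((us @ [y]) @ x # ys @ zs)"
    using assms unfolding skew_def by (metis append.assoc append_Cons append_Nil)
  then show ?case unfolding Cons[of "us @ [y]"] by simp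
qed simp

lemma skew_not_distinct:
  assumes "skew \<omega>" "\<not> distinct vs"
  shows "\<omega> vs = 0"
proof -
  obtain us ys zs x where vs: "vs = us @ [x] @ ys @ [x] @ zs"
    using not_distinct_decomp[OF assms(2)] by blast
  have "\<omega> ((us @ ys) @ x # x # zs) = - \<omega> ((us @ ys) @ x # x # zs)"
    using assms(1) unfolding skew_def by blast
  then show ?thesis using skew_move[OF assms(1), of us x ys "x # zs"] by (simp add: vs)
qed

lemma multilinear_nonzero_on_spanning_set:
  assumes \<omega>: "multilinear_on (span B) \<omega>" and vs: "set vs \<subseteq> span B" "\<omega> vs \<noteq> 0"
  shows "\<exists>us. set us \<subseteq> B \<and> length us = length vs \<and> \<omega> us \<noteq> 0"
proof (rule ccontr)
  assume neg: "\<nexists>us. set us \<subseteq> B \<and> length us = length vs \<and> \<omega> us \<noteq> 0"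
  \<comment> \<open>\<open>us\<close> holds the entries already replaced by members of
    \<open>B\<close>; the induction expands the first of the remaining entries
    \<open>ws\<close>.\<close>
  have "\<omega> (us @ ws) = 0" if "set us \<subseteq> B" "set ws \<subseteq> span B" "length us + length ws = length vs" for us ws
    using that
  proof (induction ws arbitrary: us)
    case Nil
    then show ?case using neg by auto
  next
    case (Cons w ws)
    have us: "set us \<subseteq> span B" using Cons.prems span_superset by blast
    have "w \<in> span B" using Cons.prems by auto
    then have "w \<in> span B \<and> \<omega> (us @ w # ws) = 0"
    proof (induction rule: span_induct_alt)
      case base
      \<comment> \<open>The zero vector is written as a combination with zero coefficients to fit
        multilinearity.\<close>
      have "\<omega> (us @ (0 *\<^sub>R 0 + 0 *\<^sub>R 0) # ws) = 0 * \<omega> (us @ 0 # ws) + 0 * \<omega> (us @ 0 # ws)"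
        using us Cons.prems by (intro multilinear_onD[OF \<omega>]) (auto intro: span_zero)
      then show ?case by (simp add: span_zero)
    next
      case (step c x y)
      have "\<omega> ((us @ [x]) @ ws) = 0" using Cons.prems step by (intro Cons.IH) auto
      moreover have "\<omega> (us @ (c *\<^sub>R x + 1 *\<^sub>R y) # ws) = c * \<omega> (us @ x # ws) + 1 * \<omega> (us @ y # ws)"
        using us Cons.prems step by (intro multilinear_onD[OF \<omega>]) (auto intro: span_base)
      ultimately show ?case using step by (simp add: span_add span_scale span_base)
    qed
    then show ?case by simp
  qed
  from this[of "[]" vs] vs show False by simp
qed

subsection \<open>Abelian ideals of a reductive Lie algebra with an lcs structure\<close>

definition linear_on :: "'a::real_vector set \<Rightarrow> ('a \<Rightarrow> 'b::real_vector) \<Rightarrow> bool" where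
  "linear_on g f \<longleftrightarrow> (\<forall>x\<in>g. \<forall>y\<in>g. f (x + y) = f x + f y) \<and> (\<forall>c. \<forall>x\<in>g. f (c *\<^sub>R x) = c *\<^sub>R f x)"

lemma linear_on_add: "linear_on g f \<Longrightarrow> x \<in> g \<Longrightarrow> y \<in> g \<Longrightarrow> f (x + y) = f x + f y"
  and linear_on_scale: "linear_on g f \<Longrightarrow> x \<in> g \<Longrightarrow> f (c *\<^sub>R x) = c *\<^sub>R f x"
  by (simp_all add: linear_on_def)

lemma linear_on_zero: "linear_on g f \<Longrightarrow> subspace g \<Longrightarrow> f 0 = 0"
  using linear_on_scale[of g f 0 0] by (simp add: subspace_0)

lemma linear_on_minus: "linear_on g f \<Longrightarrow> x \<in> g \<Longrightarrow> f (- x) = - f x"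
  using linear_on_scale[of g f x "- 1"] by simp

lemma linear_on_diff: "linear_on g f \<Longrightarrow> subspace g \<Longrightarrow> x \<in> g \<Longrightarrow> y \<in> g \<Longrightarrow> f (x - y) = f x - f y"
  using linear_on_add[of g f x "- y"] linear_on_minus[of g f y] by (simp add: subspace_neg)

lemma linear_on_sum:
  assumes "linear_on g f" "subspace g" "\<And>i. i \<in> I \<Longrightarrow> v i \<in> g"
  shows "f (\<Sum>i\<in>I. v i) = (\<Sum>i\<in>I. f (v i))"
  using assms(3)
proof (induction I rule: infinite_finite_induct)
  case (insert i I)
  then show ?case
    using linear_on_add[OF assms(1), of "v i" "sum v I"] subspace_sum[OF assms(2), of I v] by simp
qed (simp_all add: linear_on_zero[OF assms(1,2)])

lemma linear_on_combination:
  assumes "linear_on g f" "subspace g" "\<And>i. i \<in> I \<Longrightarrow> v i \<in> g"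
  shows "f (\<Sum>i\<in>I. c i *\<^sub>R v i) = (\<Sum>i\<in>I. c i *\<^sub>R f (v i))"
  using linear_on_sum[OF assms(1,2), of I "\<lambda>i. c i *\<^sub>R v i"] assms
  by (simp add: subspace_scale linear_on_scale)

lemma linear_on_eq_on_span:
  assumes "linear_on (span B) f" "linear_on (span B) f'" "\<And>b. b \<in> B \<Longrightarrow> f b = f' b" "x \<in> span B"
  shows "f x = f' x"
proof -
  have "x \<in> span B \<and> f x = f' x"
    using assms(4)
  proof (induction rule: span_induct_alt)
    case base
    then show ?case using assms linear_on_zero by (metis span_zero subspace_span)
  next
    case (step c x y)
    then show ?case
      using assms(1-3) by (simp add: linear_on_add linear_on_scale span_add span_scale span_base)
  qed
  then show ?thesis ..
qed

lemma linear_on_combination_of_functionals: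
  assumes "\<And>b. b \<in> B \<Longrightarrow> linear_on g (\<lambda>x. c b x)"
  shows "linear_on g (\<lambda>x. \<Sum>b\<in>B. (c b x :: real) *\<^sub>R v b)"
  unfolding linear_on_def
  using linear_on_add[OF assms] linear_on_scale[OF assms]
  by (simp add: scaleR_add_left scaleR_sum_right flip: sum.distrib)

text \<open>The map \<open>F\<close> sends \<open>y\<close> to the vector with coordinates
  \<open>W c y\<close>. Nondegeneracy makes it injective on \<open>span B\<close>, finite dimension
  makes it surjective there, and \<open>s b\<close> is the preimage of \<open>b\<close>. Comparing
  coordinates, \<open>W c (s b)\<close> is the Kronecker delta.\<close>

lemma nondegenerate_dual_basis:
  fixes W :: "'a::real_vector \<Rightarrow> 'a \<Rightarrow> real"
  assumes B: "finite B" "independent B"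
    and left: "\<And>y. y \<in> span B \<Longrightarrow> linear_on (span B) (\<lambda>x. W x y)"
    and right: "\<And>x. x \<in> span B \<Longrightarrow> linear_on (span B) (W x)"
    and nondeg: "\<And>y. y \<in> span B \<Longrightarrow> (\<And>x. x \<in> span B \<Longrightarrow> W x y = 0) \<Longrightarrow> y = 0"
  obtains s where "\<And>b. b \<in> B \<Longrightarrow> s b \<in> span B" "\<And>b. b \<in> B \<Longrightarrow> W b (s b) = 1"
    "\<And>x. x \<in> span B \<Longrightarrow> x = (\<Sum>b\<in>B. W x (s b) *\<^sub>R b)"
proof -
  let ?F = "\<lambda>y. \<Sum>c\<in>B. W c y *\<^sub>R c"
  \<comment> \<open>\<open>F\<close> is linear on the whole ambient space, as the image lemmas
    require; agreement with the formula is claimed on \<open>span B\<close> only.\<close>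
  obtain F where F: "linear F" "\<And>b. b \<in> B \<Longrightarrow> F b = ?F b"
    using linear_independent_extend[OF B(2), of ?F] by blast
  have linF: "linear_on (span B) F"
    using F(1) by (simp add: linear_on_def linear_add linear_scale)
  have "linear_on (span B) ?F"
    by (intro linear_on_combination_of_functionals right) (rule span_base)
  then have F_eq: "F y = ?F y" if "y \<in> span B" for y
    using linear_on_eq_on_span[OF linF _ F(2) that] by blast
  have expand: "W x y = 0" if y: "y \<in> span B" "?F y = 0" and x: "x \<in> span B" for x y
  proof -
    have "W b y = 0" if "b \<in> B" for b
      using independentD[OF B(2,1) subset_refl y(2) that] .
    then show ?thesis
      using linear_on_eq_on_span[OF left[OF y(1)], of "\<lambda>_. 0"] x by (simp add: linear_on_def)
  qed
  have inj: "inj_on F (span B)"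
    unfolding linear_injective_on_subspace_0[OF F(1) subspace_span]
    using F_eq expand nondeg by metis
  have surj: "\<exists>y \<in> span B. F y = b" if "b \<in> B" for b
  proof (rule ccontr)
    \<comment> \<open>A missed \<open>b\<close> could be adjoined to the independent set of images
      of \<open>B\<close>, giving \<open>card B + 1\<close> independent vectors in
      \<open>span B\<close>.\<close>
    assume "\<not> ?thesis"
    then have b: "b \<notin> span (F ` B)"
      using linear_span_image[OF F(1), of B] by auto
    have indep: "independent (F ` B)"
      using linear_independent_injective_image[OF F(1) B(2) inj] .
    have "F ` B \<subseteq> span B"
    proof clarify
      fix b assume "b \<in> B"
      then show "F b \<in> span B"
        unfolding F(2)[OF \<open>b \<in> B\<close>] by (intro span_sum span_scale span_base)
    qed
    then have "card (insert b (F ` B)) \<le> card B"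
      using independent_span_bound[OF B(1) independent_insertI[OF b indep]] that span_base by blast
    moreover have "b \<notin> F ` B" using b span_base by blast
    moreover have "card (F ` B) = card B"
      using card_image[OF inj_on_subset[OF inj span_superset]] .
    ultimately show False using B(1) by simp
  qed
  then obtain s where s: "\<And>b. b \<in> B \<Longrightarrow> s b \<in> span B" "\<And>b. b \<in> B \<Longrightarrow> F (s b) = b"
    by metis
  have delta: "W c (s b) = (if c = b then 1 else 0)" if b: "b \<in> B" and c: "c \<in> B" for b c
  proof -
    have "(\<Sum>c\<in>B. W c (s b) *\<^sub>R c) = (\<Sum>c\<in>B. (if c = b then 1 else 0) *\<^sub>R c)"
      using F_eq[OF s(1)[OF b]] s(2)[OF b] B(1) b
      by (simp add: if_distrib[of "\<lambda>r. r *\<^sub>R _"] cong: if_cong)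
    then have "(\<Sum>c\<in>B. (W c (s b) - (if c = b then 1 else 0)) *\<^sub>R c) = 0"
      by (simp add: scaleR_left_diff_distrib sum_subtractf)
    from independentD[OF B(2,1) subset_refl this c] show ?thesis by simp
  qed
  show ?thesis
  proof
    show "s b \<in> span B" if "b \<in> B" for b using s that by blast
    show "W b (s b) = 1" if "b \<in> B" for b using delta[OF that that] by simp
    show "x = (\<Sum>b\<in>B. W x (s b) *\<^sub>R b)" if "x \<in> span B" for x
    proof (rule linear_on_eq_on_span[OF _ _ _ that, where f = "\<lambda>x. x"])
      show "linear_on (span B) (\<lambda>x. \<Sum>b\<in>B. W x (s b) *\<^sub>R b)"
        by (intro linear_on_combination_of_functionals left s)
      show "b = (\<Sum>c\<in>B. W b (s c) *\<^sub>R c)" if "b \<in> B" for b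
        using delta[OF _ that] B(1) that by (simp add: if_distrib[of "\<lambda>r. r *\<^sub>R _"] cong: if_cong)
    qed (simp add: linear_on_def)
  qed
qed

section \<open>Brackets, ideals and direct sums\<close>

context lie_algebra
begin

lemma bracket_linear_right: "x \<in> g \<Longrightarrow> linear_on g (br x)"
  by (simp add: linear_on_def add_right scale_right)

lemma bracket_skew:
  assumes "x \<in> g" "y \<in> g"
  shows "br y x = - br x y"
proof -
  have "br (x + y) (x + y) = br x y + br y x"
    using assms subspace
    by (simp add: add_left add_right alternating[of x] alternating[of y] subspace_add del: alternating)
  then have "br x y + br y x = 0"
    using assms subspace by (simp add: alternating subspace_add)
  then show ?thesis by (simp add: eq_neg_iff_add_eq_0 add.commute)
qed

text \<open>The Jacobi identity in the form that makes the adjoint map a homomorphism, as needed for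
  traces of commutators.\<close>

lemma bracket_bracket:
  assumes "x \<in> g" "y \<in> g" "z \<in> g"
  shows "br (br x y) z = br x (br y z) - br y (br x z)"
proof -
  have "br z (br x y) = - br (br x y) z" "br y (br z x) = - br y (br x z)"
    using assms bracket_skew[of "br x y" z] bracket_skew[of x z]
      linear_on_minus[OF bracket_linear_right] closed by simp_all
  then show ?thesis using jacobi[OF assms] by (simp add: algebra_simps)
qed

text \<open>Bracketing with \<open>z\<close> is a derivation, so it maps a generator
  \<open>br x y\<close> to a sum of two generators.\<close>

lemma lie_ideal_derived:
  assumes "lie_ideal g br a"
  shows "lie_ideal g br (derived_algebra br a)" "derived_algebra br a \<subseteq> a"
proof -
  have a: "subspace a" "a \<subseteq> g" "\<And>x y. x \<in> g \<Longrightarrow> y \<in> a \<Longrightarrow> br x y \<in> a"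
    using assms by (auto simp: lie_ideal_def)
  show sub: "derived_algebra br a \<subseteq> a"
    unfolding derived_algebra_def using a by (intro span_minimal) auto
  have "derived_algebra br a \<subseteq> {w \<in> g. br z w \<in> derived_algebra br a}" if z: "z \<in> g" for z
    unfolding derived_algebra_def[of br a]
  proof (rule span_minimal)
    show "subspace {w \<in> g. br z w \<in> span {br x y |x y. x \<in> a \<and> y \<in> a}}"
      using z bracket_linear_right[OF z] subspace
      by (auto simp: subspace_def[of "Collect _"] linear_on_zero linear_on_add linear_on_scale
        subspace_0 subspace_add subspace_scale span_zero span_add span_scale)
    show "{br x y |x y. x \<in> a \<and> y \<in> a} \<subseteq> {w \<in> g. br z w \<in> span {br x y |x y. x \<in> a \<and> y \<in> a}}"
    proof clarify
      fix x y assume xy: "x \<in> a" "y \<in> a"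
      then have g: "x \<in> g" "y \<in> g" using a by auto
      have "br z (br x y) = br (br z x) y + br x (br z y)"
        using bracket_bracket[OF z g] by simp
      moreover have "br (br z x) y \<in> span {br x y |x y. x \<in> a \<and> y \<in> a}"
        "br x (br z y) \<in> span {br x y |x y. x \<in> a \<and> y \<in> a}"
        using xy a(3)[OF z] by (blast intro: span_base)+
      ultimately show "br x y \<in> g \<and> br z (br x y) \<in> span {br x y |x y. x \<in> a \<and> y \<in> a}"
        using g closed by (simp add: span_add)
    qed
  qed
  then show "lie_ideal g br (derived_algebra br a)"
    using sub a(2) by (auto simp: lie_ideal_def derived_algebra_def)
qed

lemma lie_direct_sum_commute:
  assumes "lie_direct_sum g br a b" "x \<in> a" "y \<in> b"
  shows "br x y = 0"
proof -
  have a: "subspace a" "a \<subseteq> g" "\<And>x y. x \<in> g \<Longrightarrow> y \<in> a \<Longrightarrow> br x y \<in> a"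
    and b: "b \<subseteq> g" "\<And>x y. x \<in> g \<Longrightarrow> y \<in> b \<Longrightarrow> br x y \<in> b" and ab: "a \<inter> b = {0}"
    using assms(1) by (auto simp: lie_direct_sum_def lie_ideal_def)
  have "br y x \<in> a" "br x y \<in> b" using a b assms by auto
  moreover have "br x y = - br y x" using a b assms by (intro bracket_skew) auto
  ultimately have "br x y \<in> a \<inter> b" using subspace_neg[OF a(1)] by simp
  then show ?thesis using ab by simp
qed

lemma lie_direct_sum_decompose:
  assumes "lie_direct_sum g br a b" "x \<in> g"
  obtains y z where "y \<in> a" "z \<in> b" "x = y + z" "y \<in> g" "z \<in> g"
proof -
  have "x \<in> {x + y |x y. x \<in> a \<and> y \<in> b}" "a \<subseteq> g" "b \<subseteq> g"
    using assms by (auto simp: lie_direct_sum_def lie_ideal_def)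
  then show ?thesis using that by blast
qed

lemma abelian_summand_central:
  assumes "lie_direct_sum g br a b" "\<And>x y. x \<in> a \<Longrightarrow> y \<in> a \<Longrightarrow> br x y = 0" "x \<in> a" "y \<in> g"
  shows "br x y = 0"
proof -
  obtain u v where y: "u \<in> a" "v \<in> b" "y = u + v" "u \<in> g" "v \<in> g"
    using lie_direct_sum_decompose[OF assms(1,4)] .
  have "x \<in> g" using assms(1,3) by (auto simp: lie_direct_sum_def lie_ideal_def)
  then show ?thesis
    using y assms lie_direct_sum_commute[OF assms(1,3) y(2)] by (simp add: add_right)
qed

text \<open>Since \<open>a\<close> is central, every bracket in \<open>g\<close> equals one whose
  second argument lies in \<open>b\<close>. It follows that \<open>a\<close> meets the derived
  algebra trivially.\<close>

lemma abelian_summand_derived: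
  assumes "lie_direct_sum g br a b" "\<And>x y. x \<in> a \<Longrightarrow> y \<in> a \<Longrightarrow> br x y = 0"
  shows "derived_algebra br g \<subseteq> b"
  unfolding derived_algebra_def
proof (rule span_minimal)
  have a: "a \<subseteq> g" and b: "b \<subseteq> g" "\<And>x y. x \<in> g \<Longrightarrow> y \<in> b \<Longrightarrow> br x y \<in> b"
    using assms(1) by (auto simp: lie_direct_sum_def lie_ideal_def)
  show "subspace b" using assms(1) by (auto simp: lie_direct_sum_def lie_ideal_def)
  show "{br x y |x y. x \<in> g \<and> y \<in> g} \<subseteq> b"
  proof clarify
    fix x y assume x: "x \<in> g" and y: "y \<in> g"
    obtain u v where v: "u \<in> a" "v \<in> b" "y = u + v" "u \<in> g" "v \<in> g"
      using lie_direct_sum_decompose[OF assms(1) y] .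
    have "br x u = - br u x" using bracket_skew x v by blast
    also have "\<dots> = 0" using abelian_summand_central[OF assms v(1) x] by simp
    finally show "br x y \<in> b" using b(2)[OF x v(2)] x v by (simp add: add_right)
  qed
qed

text \<open>A bracket with an element of the ideal \<open>c\<close> lies both in \<open>c\<close>
  and in the derived algebra.\<close>

lemma complement_of_derived_central:
  assumes "lie_direct_sum g br (derived_algebra br g) c" "x \<in> c" "y \<in> g"
  shows "br x y = 0"
proof -
  have c: "c \<subseteq> g" "\<And>x y. x \<in> g \<Longrightarrow> y \<in> c \<Longrightarrow> br x y \<in> c" "derived_algebra br g \<inter> c = {0}"
    using assms(1) by (auto simp: lie_direct_sum_def lie_ideal_def)
  have "br y x \<in> derived_algebra br g"
    using assms c(1) unfolding derived_algebra_def by (intro span_base) auto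
  moreover have "br y x \<in> c" using c assms by blast
  ultimately have "br y x = 0" using c(3) by blast
  then show ?thesis using bracket_skew[of y x] assms c(1) by auto
qed

lemma lie_ideal_self: "lie_ideal g br g"
  using subspace closed by (auto simp: lie_ideal_def)

lemma finite_basis:
  obtains B where "finite B" "independent B" "span B = g" "card B = dim g"
proof -
  obtain C where C: "finite C" "span C = g" using finite_dim by blast
  obtain B where B: "B \<subseteq> g" "independent B" "g \<subseteq> span B" "card B = dim g"
    using basis_exists by blast
  have "finite B" using independent_span_bound[OF C(1) B(2)] B(1) C(2) by blast
  moreover have "span B = g" using span_minimal[OF B(1) subspace] B(3) by blast
  ultimately show ?thesis using that B by blast
qed

end

text \<open>The forms appear as plain functions of vectors: \<open>W\<close> is the two-form,
  \<open>\<theta>\<close> the Lee form, and \<open>lcs\<close> is the equation for the differential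
  of the two-form on three vectors. The bound on the dimension allows division by
  \<open>dim g - 2\<close>.\<close>

locale reductive_lcs = lie_algebra g br for g :: "'a::real_vector set" and br +
  fixes W :: "'a \<Rightarrow> 'a \<Rightarrow> real" and \<theta> :: "'a \<Rightarrow> real"
  assumes reductive: "reductive g br"
    and form_left: "y \<in> g \<Longrightarrow> linear_on g (\<lambda>x. W x y)"
    and form_right: "x \<in> g \<Longrightarrow> linear_on g (W x)"
    and form_skew: "x \<in> g \<Longrightarrow> y \<in> g \<Longrightarrow> W y x = - W x y"
    and nondegenerate: "x \<in> g \<Longrightarrow> (\<And>y. y \<in> g \<Longrightarrow> W x y = 0) \<Longrightarrow> x = 0"
    and lee_linear: "linear_on g \<theta>"
    and lcs: "x \<in> g \<Longrightarrow> y \<in> g \<Longrightarrow> z \<in> g \<Longrightarrow>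
      - W (br x y) z + W (br x z) y - W (br y z) x = \<theta> x * W y z - \<theta> y * W x z + \<theta> z * W x y"
    and dim: "dim g > 2"
begin

lemma ideal_complement: "lie_ideal g br a \<Longrightarrow> \<exists>b. lie_direct_sum g br a b"
  using reductive by (simp add: reductive_def)

text \<open>Reductivity enters through the trace of \<open>br v\<close>: it vanishes for
  \<open>v\<close> in the derived algebra because traces kill commutators, and for \<open>v\<close>
  in a complement because such \<open>v\<close> is central.\<close>

lemma lee_form_represented_in_derived:
  obtains w where "w \<in> derived_algebra br g" "\<And>v. v \<in> g \<Longrightarrow> W w v = \<theta> v"
proof -
  obtain B where B: "finite B" "independent B" "span B = g" "card B = dim g"
    using finite_basis .
  have nondeg': "y = 0" if "y \<in> g" "\<And>x. x \<in> g \<Longrightarrow> W x y = 0" for y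
    using nondegenerate[OF that(1)] form_skew[of _ y] that by simp
  obtain s where s: "\<And>b. b \<in> B \<Longrightarrow> s b \<in> g" "\<And>b. b \<in> B \<Longrightarrow> W b (s b) = 1"
    and exp1: "\<And>x. x \<in> g \<Longrightarrow> x = (\<Sum>b\<in>B. W x (s b) *\<^sub>R b)"
    using nondegenerate_dual_basis[OF B(1,2), of W, unfolded B(3), OF form_left form_right nondeg'] by blast
  have Bg: "b \<in> g" if "b \<in> B" for b using B(3) that span_base by blast
  have comb_g: "(\<Sum>b\<in>B. c b *\<^sub>R f b) \<in> g" if "\<And>b. b \<in> B \<Longrightarrow> f b \<in> g" for c f
    using that subspace by (intro subspace_sum subspace_scale) auto
  \<comment> \<open>The expansion in the dual basis: by \<open>exp1\<close> both sides pair equally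
    with every \<open>x\<close>, and \<open>nondeg'\<close> applies.\<close>
  have exp2: "y = (\<Sum>b\<in>B. W b y *\<^sub>R s b)" if y: "y \<in> g" for y
  proof -
    have "W x (y - (\<Sum>b\<in>B. W b y *\<^sub>R s b)) = 0" if x: "x \<in> g" for x
    proof -
      have "W x y = W (\<Sum>b\<in>B. W x (s b) *\<^sub>R b) y" by (rule arg_cong[where f = "\<lambda>z. W z y", OF exp1[OF x]])
      also have "\<dots> = (\<Sum>b\<in>B. W x (s b) * W b y)"
        using linear_on_combination[OF form_left[OF y] subspace Bg] by simp
      also have "\<dots> = W x (\<Sum>b\<in>B. W b y *\<^sub>R s b)"
        using linear_on_combination[OF form_right[OF x] subspace s(1), of B "\<lambda>b. b"] by (simp add: mult.commute)
      finally show ?thesis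
        using linear_on_diff[OF form_right[OF x] subspace y comb_g] s(1) by simp
    qed
    then have "y - (\<Sum>b\<in>B. W b y *\<^sub>R s b) = 0"
      using y s(1) comb_g subspace by (intro nondeg') (auto intro!: subspace_diff)
    then show ?thesis by simp
  qed
  \<comment> \<open>The trace, which \<open>tr_dual\<close> recomputes in the dual basis. Adding the two expressions for the
    vanishing trace of \<open>br v\<close> and applying \<open>lcs\<close> gives \<open>Ww\<close> below.\<close>
  define tr where "tr A = (\<Sum>b\<in>B. W (A b) (s b))" for A
  have tr_dual: "tr A = (\<Sum>b\<in>B. W b (A (s b)))"
    if A: "linear_on g A" "\<And>x. x \<in> g \<Longrightarrow> A x \<in> g" for A
  proof -
    have "W (A b) (s b) = (\<Sum>c\<in>B. W c b * W (A (s c)) (s b))" if b: "b \<in> B" for b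
    proof -
      have "A b = A (\<Sum>c\<in>B. W c b *\<^sub>R s c)" by (rule arg_cong[where f = A, OF exp2[OF Bg[OF b]]])
      also have "\<dots> = (\<Sum>c\<in>B. W c b *\<^sub>R A (s c))"
        using linear_on_combination[OF A(1) subspace s(1)] .
      finally show ?thesis
        using linear_on_combination[OF form_left[OF s(1)[OF b]] subspace A(2)[OF s(1)]] by simp
    qed
    then have "tr A = (\<Sum>b\<in>B. \<Sum>c\<in>B. W c b * W (A (s c)) (s b))" by (simp add: tr_def)
    also have "\<dots> = (\<Sum>c\<in>B. \<Sum>b\<in>B. W c b * W (A (s c)) (s b))" by (rule sum.swap)
    also have "\<dots> = (\<Sum>c\<in>B. W c (A (s c)))"
    proof (rule sum.cong[OF refl])
      fix c assume c: "c \<in> B"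
      have "W c (A (s c)) = W c (\<Sum>b\<in>B. W (A (s c)) (s b) *\<^sub>R b)"
        by (rule arg_cong[where f = "W c", OF exp1[OF A(2)[OF s(1)[OF c]]]])
      also have "\<dots> = (\<Sum>b\<in>B. W (A (s c)) (s b) * W c b)"
        using linear_on_combination[OF form_right[OF Bg[OF c]] subspace Bg] by simp
      finally show "(\<Sum>b\<in>B. W c b * W (A (s c)) (s b)) = W c (A (s c))" by (simp add: mult.commute)
    qed
    finally show ?thesis .
  qed
  \<comment> \<open>\<open>W (br y b) (s c)\<close> is a matrix entry of \<open>br y\<close>, so
    this is the trace of a matrix product; exchanging the sums shows that it is symmetric in
    \<open>x\<close> and \<open>y\<close>.\<close>
  have tr_comp: "tr (\<lambda>z. br x (br y z)) = (\<Sum>b\<in>B. \<Sum>c\<in>B. W (br y b) (s c) * W (br x c) (s b))"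
    if x: "x \<in> g" and y: "y \<in> g" for x y
    unfolding tr_def
  proof (rule sum.cong[OF refl])
    fix b assume b: "b \<in> B"
    have "br x (br y b) = br x (\<Sum>c\<in>B. W (br y b) (s c) *\<^sub>R c)"
      by (rule arg_cong[where f = "br x", OF exp1[OF closed[OF y Bg[OF b]]]])
    also have "\<dots> = (\<Sum>c\<in>B. W (br y b) (s c) *\<^sub>R br x c)"
      using linear_on_combination[OF bracket_linear_right[OF x] subspace Bg] .
    finally show "W (br x (br y b)) (s b) = (\<Sum>c\<in>B. W (br y b) (s c) * W (br x c) (s b))"
      using linear_on_combination[OF form_left[OF s(1)[OF b]] subspace closed[OF x Bg]] by simp
  qed
  have tr_bracket: "tr (br (br x y)) = 0" if x: "x \<in> g" and y: "y \<in> g" for x y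
  proof -
    have "tr (br (br x y)) = tr (\<lambda>z. br x (br y z)) - tr (\<lambda>z. br y (br x z))"
      unfolding tr_def sum_subtractf[symmetric]
    proof (rule sum.cong[OF refl])
      fix b assume b: "b \<in> B"
      show "W (br (br x y) b) (s b) = W (br x (br y b)) (s b) - W (br y (br x b)) (s b)"
        unfolding bracket_bracket[OF x y Bg[OF b]]
        using linear_on_diff[OF form_left[OF s(1)[OF b]] subspace] closed x y Bg[OF b] by simp
    qed
    also have "\<dots> = 0"
      unfolding tr_comp[OF x y] tr_comp[OF y x]
      by (subst sum.swap) (simp add: mult.commute)
    finally show ?thesis .
  qed
  have tr_add: "tr (br (x + y)) = tr (br x) + tr (br y)" if "x \<in> g" "y \<in> g" for x y
    unfolding tr_def sum.distrib[symmetric]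
    by (rule sum.cong[OF refl])
      (use that Bg s(1) closed in \<open>simp add: add_left linear_on_add[OF form_left]\<close>)
  have tr_scale: "tr (br (c *\<^sub>R x)) = c * tr (br x)" if "x \<in> g" for c x
    unfolding tr_def sum_distrib_left
    by (rule sum.cong[OF refl])
      (use that Bg s(1) closed in \<open>simp add: scale_left linear_on_scale[OF form_left]\<close>)
  have tr_derived: "derived_algebra br g \<subseteq> {x \<in> g. tr (br x) = 0}"
    unfolding derived_algebra_def
  proof (rule span_minimal)
    have "tr (br 0) = 0" using tr_scale[of 0 0] subspace by (simp add: subspace_0)
    then show "subspace {x \<in> g. tr (br x) = 0}"
      using subspace by (auto simp: subspace_def[of "Collect _"] tr_add tr_scale
        subspace_0 subspace_add subspace_scale)
  qed (use tr_bracket closed in auto)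
  obtain c where c: "lie_direct_sum g br (derived_algebra br g) c"
    using ideal_complement lie_ideal_derived(1)[OF lie_ideal_self] by blast
  have unimodular: "tr (br v) = 0" if v: "v \<in> g" for v
  proof -
    obtain x y where xy: "x \<in> derived_algebra br g" "y \<in> c" "v = x + y" "x \<in> g" "y \<in> g"
      using lie_direct_sum_decompose[OF c v] .
    have "tr (br y) = 0"
      unfolding tr_def using complement_of_derived_central[OF c xy(2)] Bg
        linear_on_zero[OF form_left[OF s(1)] subspace] by simp
    then show ?thesis using xy tr_derived by (auto simp: tr_add)
  qed
  define w where "w = (\<Sum>b\<in>B. br b (s b))"
  have w: "w \<in> derived_algebra br g"
    unfolding w_def derived_algebra_def using Bg s(1) by (intro span_sum span_base) auto
  have Ww: "W w v = - (real (dim g) - 2) * \<theta> v" if v: "v \<in> g" for v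
  proof -
    have "(\<Sum>b\<in>B. - W (br v b) (s b) + W (br v (s b)) b - W (br b (s b)) v)
        = (\<Sum>b\<in>B. \<theta> v * W b (s b) - \<theta> b * W v (s b) + \<theta> (s b) * W v b)"
      using lcs v Bg s(1) by (intro sum.cong) auto
    moreover have "(\<Sum>b\<in>B. - W (br v b) (s b) + W (br v (s b)) b - W (br b (s b)) v) = - W w v"
    proof -
      have "(\<Sum>b\<in>B. W (br v (s b)) b) = - (\<Sum>b\<in>B. W b (br v (s b)))"
        unfolding sum_negf[symmetric] by (intro sum.cong form_skew closed v Bg s(1) refl)
      also have "\<dots> = 0"
        using tr_dual[OF bracket_linear_right[OF v]] closed v unimodular by simp
      finally have 1: "(\<Sum>b\<in>B. W (br v (s b)) b) = 0" .
      have 2: "W w v = (\<Sum>b\<in>B. W (br b (s b)) v)"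
        unfolding w_def by (rule linear_on_sum[OF form_left[OF v] subspace]) (intro closed Bg s(1))
      have 3: "(\<Sum>b\<in>B. W (br v b) (s b)) = 0" using unimodular[OF v] by (simp add: tr_def)
      show ?thesis by (simp add: sum.distrib sum_subtractf sum_negf 1 2 3)
    qed
    \<comment> \<open>The first sum is \<open>dim g\<close> times \<open>\<theta> v\<close>, as
      \<open>W b (s b) = 1\<close>. Each of the other two contributes \<open>- \<theta> v\<close>,
      by \<open>exp1\<close> and by \<open>exp2\<close> with skewness.\<close>
    moreover have "(\<Sum>b\<in>B. \<theta> v * W b (s b) - \<theta> b * W v (s b) + \<theta> (s b) * W v b) = (real (dim g) - 2) * \<theta> v"
    proof -
      have "\<theta> v = \<theta> (\<Sum>b\<in>B. W v (s b) *\<^sub>R b)" by (rule arg_cong[where f = \<theta>, OF exp1[OF v]])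
      then have 1: "(\<Sum>b\<in>B. \<theta> b * W v (s b)) = \<theta> v"
        using linear_on_combination[where I = B and v = "\<lambda>b. b", OF lee_linear subspace Bg] by (simp add: mult.commute)
      have "\<theta> v = \<theta> (\<Sum>b\<in>B. W b v *\<^sub>R s b)" by (rule arg_cong[where f = \<theta>, OF exp2[OF v]])
      also have "\<dots> = (\<Sum>b\<in>B. W b v * \<theta> (s b))"
        using linear_on_combination[where I = B and v = s, OF lee_linear subspace s(1)] by simp
      also have "\<dots> = - (\<Sum>b\<in>B. \<theta> (s b) * W v b)"
        unfolding sum_negf[symmetric]
      proof (rule sum.cong[OF refl])
        fix b assume "b \<in> B"
        then show "W b v * \<theta> (s b) = - (\<theta> (s b) * W v b)"
          by (subst form_skew[OF v Bg]) simp_all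
      qed
      finally have 2: "(\<Sum>b\<in>B. \<theta> (s b) * W v b) = - \<theta> v" by simp
      show ?thesis
        using 1 2 s(2) B(4) by (simp add: sum.distrib sum_subtractf algebra_simps)
    qed
    ultimately have "- W w v = (real (dim g) - 2) * \<theta> v" by (simp only:)
    then show ?thesis by (metis minus_equation_iff mult_minus_left)
  qed
  \<comment> \<open>The factor that turns \<open>Ww\<close> into the claim; the divisor is nonzero
    because \<open>dim g > 2\<close>.\<close>
  define c where "c = - 1 / (real (dim g) - 2)"
  have wg: "w \<in> g" using w lie_ideal_derived[OF lie_ideal_self] by blast
  show ?thesis
  proof
    show "c *\<^sub>R w \<in> derived_algebra br g"
      using w unfolding derived_algebra_def by (rule span_scale)
    show "W (c *\<^sub>R w) v = \<theta> v" if "v \<in> g" for v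
    proof -
      have "c * (real (dim g) - 2) = - 1" using dim by (simp add: c_def)
      moreover have "W (c *\<^sub>R w) v = - (c * (real (dim g) - 2)) * \<theta> v"
        unfolding linear_on_scale[OF form_left[OF that] wg] Ww[OF that] by (simp add: algebra_simps)
      ultimately show ?thesis by simp
    qed
  qed
qed

lemma abelian_ideal_in_lee_kernel_trivial:
  assumes T: "T \<in> g" "\<theta> T = 1" "\<And>y. y \<in> g \<Longrightarrow> br T y = 0"
    and a: "lie_ideal g br a" "\<And>x. x \<in> a \<Longrightarrow> \<theta> x = 0" "\<And>x y. x \<in> a \<Longrightarrow> y \<in> a \<Longrightarrow> br x y = 0"
  shows "a = {0}"
proof -
  obtain c where c: "lie_direct_sum g br a c" using ideal_complement[OF a(1)] ..
  obtain w where w: "w \<in> derived_algebra br g" "\<And>v. v \<in> g \<Longrightarrow> W w v = \<theta> v"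
    using lee_form_represented_in_derived by blast
  have wg: "w \<in> g" using w lie_ideal_derived[OF lie_ideal_self] by blast
  have "z = 0" if z: "z \<in> a" for z
  proof -
    have zg: "z \<in> g" using a(1) z by (auto simp: lie_ideal_def)
    have zc: "br z y = 0" if "y \<in> g" for y
      using abelian_summand_central[OF c a(3) z that] .
    \<comment> \<open>In \<open>lcs\<close> at \<open>z\<close>, \<open>T\<close>, \<open>y\<close>
      all brackets vanish since \<open>z\<close> and \<open>T\<close> are central; what remains is
      \<open>0 = - W z y + \<theta> y * W z T\<close>, by \<open>\<theta> z = 0\<close> and
      \<open>\<theta> T = 1\<close>.\<close>
    have Wz: "W z y = W z T * \<theta> y" if y: "y \<in> g" for y
      using lcs[OF zg T(1) y] zc T y zg a(2)[OF z] linear_on_zero[OF form_left subspace]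
      by (simp add: mult.commute)
    have "z - W z T *\<^sub>R w = 0"
    proof (rule nondegenerate)
      show "z - W z T *\<^sub>R w \<in> g" using zg wg subspace by (simp add: subspace_diff subspace_scale)
      show "W (z - W z T *\<^sub>R w) y = 0" if y: "y \<in> g" for y
        using linear_on_diff[OF form_left[OF y] subspace zg, of "W z T *\<^sub>R w"]
          linear_on_scale[OF form_left[OF y] wg] Wz[OF y] w(2)[OF y] wg subspace
        by (simp add: subspace_scale)
    qed
    then have "z = W z T *\<^sub>R w" by simp
    then have "z \<in> derived_algebra br g"
      using span_scale[OF w(1)[unfolded derived_algebra_def], of "W z T"] unfolding derived_algebra_def by simp
    \<comment> \<open>The derived algebra, which contains \<open>z\<close> as a multiple of
      \<open>w\<close>, lies in the complement \<open>c\<close> of the abelian ideal.\<close>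
    then have "z \<in> a \<inter> c" using abelian_summand_derived[OF c a(3)] z by blast
    then show ?thesis using c unfolding lie_direct_sum_def by blast
  qed
  moreover have "0 \<in> a" using a(1) by (simp add: lie_ideal_def subspace_0)
  ultimately show ?thesis by blast
qed

text \<open>Induction on the derived length: the derived algebra of \<open>a\<close> is again an
  ideal of \<open>g\<close> in the kernel, hence zero, so \<open>a\<close> is abelian.\<close>

lemma solvable_ideal_in_lee_kernel_trivial:
  assumes T: "T \<in> g" "\<theta> T = 1" "\<And>y. y \<in> g \<Longrightarrow> br T y = 0"
    and "lie_ideal g br a" "\<And>x. x \<in> a \<Longrightarrow> \<theta> x = 0" "(derived_algebra br ^^ k) a = {0}"
  shows "a = {0}"
  using assms(4-)
proof (induction k arbitrary: a)
  case (Suc k)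
  note D = lie_ideal_derived[OF Suc.prems(1)]
  have "derived_algebra br a = {0}"
  proof (rule Suc.IH[OF D(1)])
    show "\<theta> x = 0" if "x \<in> derived_algebra br a" for x
      using D(2) Suc.prems(2) that by blast
    show "(derived_algebra br ^^ k) (derived_algebra br a) = {0}"
      using Suc.prems(3) by (simp only: funpow_Suc_right o_apply)
  qed
  then have "br x y = 0" if "x \<in> a" "y \<in> a" for x y
    using span_base[of "br x y" "{br x y |x y. x \<in> a \<and> y \<in> a}"] that
    unfolding derived_algebra_def by blast
  then show ?case
    using abelian_ideal_in_lee_kernel_trivial[OF T Suc.prems(1,2)] by blast
qed simp

end

subsection \<open>The contact form\<close>

lemma forms_homogeneous: "\<omega> \<in> forms g k \<Longrightarrow> homogeneous k \<omega>"
  and forms_supported_on: "\<omega> \<in> forms g k \<Longrightarrow> supported_on g \<omega>"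
  by (auto simp: forms_def homogeneous_def supported_on_def)

lemma forms_multilinear_on:
  assumes "\<omega> \<in> forms g k"
  shows "multilinear_on g \<omega>"
  unfolding multilinear_on_def
proof (intro allI impI)
  fix us ws x y a b
  assume *: "set us \<subseteq> g" "set ws \<subseteq> g" "x \<in> g" "y \<in> g"
  show "\<omega> (us @ (a *\<^sub>R x + b *\<^sub>R y) # ws) = a * \<omega> (us @ x # ws) + b * \<omega> (us @ y # ws)"
  proof (cases "length us + length ws + 1 = k")
    case True
    then show ?thesis using assms * unfolding forms_def by blast
  next
    case False
    then show ?thesis using homogeneousD[OF forms_homogeneous[OF assms]] by simp
  qed
qed

text \<open>Polarisation: expand the vanishing value with \<open>x + y\<close> repeated. If some
  entry lies outside \<open>g\<close>, both values vanish.\<close>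

lemma forms_skew:
  assumes g: "subspace g" and \<omega>: "\<omega> \<in> forms g k"
  shows "skew \<omega>"
  unfolding skew_def
proof (intro allI)
  fix us x y vs
  show "\<omega> (us @ x # y # vs) = - \<omega> (us @ y # x # vs)"
  proof (cases "set (us @ x # y # vs) \<subseteq> g")
    case True
    note lin = multilinear_onD[OF forms_multilinear_on[OF \<omega>], of _ _ _ _ 1 1, simplified]
    have rep0: "\<omega> (us @ z # z # vs) = 0" for z
      using \<omega> by (simp add: forms_def)
    have "\<omega> (us @ (x + y) # (x + y) # vs)
        = \<omega> (us @ x # (x + y) # vs) + \<omega> (us @ y # (x + y) # vs)"
      using True g by (intro lin) (auto intro: subspace_add)
    also have "\<omega> (us @ x # (x + y) # vs) = \<omega> (us @ x # x # vs) + \<omega> (us @ x # y # vs)"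
      using True lin[of "us @ [x]" vs x y] by simp
    also have "\<omega> (us @ y # (x + y) # vs) = \<omega> (us @ y # x # vs) + \<omega> (us @ y # y # vs)"
      using True lin[of "us @ [y]" vs x y] by simp
    finally show ?thesis using rep0 by simp
  next
    case False
    then have "\<not> set (us @ y # x # vs) \<subseteq> g" by auto
    then have "\<omega> (us @ x # y # vs) = 0" "\<omega> (us @ y # x # vs) = 0"
      using False forms_supported_on[OF \<omega>] unfolding supported_on_def by blast+
    then show ?thesis by simp
  qed
qed

text \<open>The zeros off \<open>s\<close> and off length one are the default values that
  \<open>forms\<close> prescribes.\<close>

definition one_form :: "'a set \<Rightarrow> ('a \<Rightarrow> real) \<Rightarrow> 'a form" where
  "one_form s f vs = (case vs of [x] \<Rightarrow> if x \<in> s then f x else 0 | _ \<Rightarrow> 0)"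

lemma one_form_single [simp]: "one_form s f [x] = (if x \<in> s then f x else 0)"
  by (simp add: one_form_def)

lemma one_form_homogeneous: "homogeneous 1 (one_form s f)"
  by (auto simp: homogeneous_def one_form_def split: list.split)

lemma one_form_in_forms:
  assumes "subspace s" "linear_on s f"
  shows "one_form s f \<in> forms s 1"
  using assms
  by (auto simp: forms_def one_form_def linear_on_add linear_on_scale subspace_add subspace_scale
      split: list.split)

lemma ce_d_two: "ce_d g br \<omega> [x, y] = (if x \<in> g \<and> y \<in> g then - \<omega> [br x y] else 0)"
  by (simp add: ce_d_def numeral_2_eq_2 nths_Cons)

lemma ce_d_three:
  "x \<in> g \<Longrightarrow> y \<in> g \<Longrightarrow> z \<in> g \<Longrightarrow>
    ce_d g br \<omega> [x, y, z] = - \<omega> [br x y, z] + \<omega> [br x z, y] - \<omega> [br y z, x]"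
  by (simp add: ce_d_def numeral_3_eq_3 nths_Cons)

lemma ce_d_supported_on: "supported_on g (ce_d g br \<omega>)"
  by (simp add: supported_on_def ce_d_def)

lemma ce_d_homogeneous:
  assumes "homogeneous k \<omega>"
  shows "homogeneous (Suc k) (ce_d g br \<omega>)"
  unfolding homogeneous_def
proof (intro allI impI)
  fix vs :: "'a list" assume len: "length vs \<noteq> Suc k"
  \<comment> \<open>Two entries are dropped and the bracket is added, so the list has length
    \<open>length vs - 1\<close>, which differs from \<open>k\<close>.\<close>
  have "\<omega> (br (vs ! i) (vs ! j) # nths vs (- {i, j})) = 0" if "j < length vs" "i < j" for i j
  proof -
    have "{l. l < length vs \<and> l \<in> - {i, j}} = {..<length vs} - {i, j}" by auto
    then have "length (nths vs (- {i, j})) = length vs - 2"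
      using that by (simp add: length_nths card_Diff_subset)
    then show ?thesis using len that by (intro homogeneousD[OF assms]) simp
  qed
  then show "ce_d g br \<omega> vs = 0" by (simp add: ce_d_def)
qed

text \<open>The end of the recursion \<open>wedge_Cons\<close>, reached when the left factor is
  fully contracted.\<close>

lemma wedge_degree_0: "homogeneous 0 \<alpha> \<Longrightarrow> wedge \<alpha> \<beta> vs = \<alpha> [] * \<beta> vs"
proof (induction vs arbitrary: \<beta>)
  case (Cons x vs)
  then show ?case
    using interior_homogeneous_0[of \<alpha> x] wedge_Cons[of 0 \<alpha> \<beta> x vs]
    by (simp add: interior_product_def[of x \<beta>])
qed simp

lemma wedge_one_Cons:
  "homogeneous 1 \<alpha> \<Longrightarrow> wedge \<alpha> \<beta> (x # vs) = \<alpha> [x] * \<beta> vs - wedge \<alpha> (ip x \<beta>) vs"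
  using wedge_Cons[of 1 \<alpha> \<beta> x vs] wedge_degree_0[OF homogeneous_interior[of 0 \<alpha> x]]
  by (simp add: interior_product_def[of x \<alpha>])

lemma wedge_one_two:
  "homogeneous 1 \<alpha> \<Longrightarrow> homogeneous 1 \<beta> \<Longrightarrow> wedge \<alpha> \<beta> [x, y] = \<alpha> [x] * \<beta> [y] - \<alpha> [y] * \<beta> [x]"
  by (simp add: wedge_one_Cons interior_product_def homogeneousD)

lemma wedge_one_three:
  "homogeneous 1 \<alpha> \<Longrightarrow>
    wedge \<alpha> \<beta> [x, y, z] = \<alpha> [x] * \<beta> [y, z] - \<alpha> [y] * \<beta> [x, z] + \<alpha> [z] * \<beta> [x, y]"
  by (simp add: wedge_one_Cons interior_product_def homogeneousD)

text \<open>A list from \<open>B\<close> with nonzero value has distinct entries and length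
  \<open>card B\<close>, so it enumerates \<open>B\<close>; moving \<open>x\<close> to the front
  changes only the sign. It is applied to a vector in the radical of \<open>\<Omega>\<close> and to
  \<open>T\<close>.\<close>

lemma top_form_interior_nonzero:
  fixes B :: "'a::real_vector set"
  assumes B: "finite B" "x \<in> B"
    and \<omega>: "homogeneous (card B) \<omega>" "skew \<omega>" "multilinear_on (span B) \<omega>" "supported_on (span B) \<omega>"
    and nz: "\<omega> \<noteq> 0"
  obtains vs where "set vs \<subseteq> B - {x}" "\<omega> (x # vs) \<noteq> 0"
proof -
  obtain us where us: "\<omega> us \<noteq> 0" using nz by (auto simp: fun_eq_iff)
  then have "set us \<subseteq> span B" using \<omega>(4) unfolding supported_on_def by blast
  then obtain ws where ws: "set ws \<subseteq> B" "\<omega> ws \<noteq> 0"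
    using multilinear_nonzero_on_spanning_set[OF \<omega>(3) _ us] by blast
  have dist: "distinct ws" using skew_not_distinct[OF \<omega>(2)] ws(2) by blast
  have "length ws = card B" using homogeneousD[OF \<omega>(1)] ws(2) by blast
  then have "set ws = B"
    using card_subset_eq[OF B(1) ws(1)] distinct_card[OF dist] by simp
  then obtain ys zs where w: "ws = ys @ x # zs" using B(2) split_list by metis
  have "\<omega> (x # ys @ zs) \<noteq> 0"
    using skew_move[OF \<omega>(2), of "[]" x ys zs] ws(2) w by auto
  moreover have "set (ys @ zs) \<subseteq> B - {x}" using w dist ws(1) by auto
  ultimately show ?thesis using that by blast
qed

lemma (in lie_algebra) lie_subalgebra:
  assumes "subspace h" "h \<subseteq> g" "\<And>x y. x \<in> h \<Longrightarrow> y \<in> h \<Longrightarrow> br x y \<in> h"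
  shows "lie_algebra h br"
proof
  obtain C where C: "finite C" "span C = g" using finite_dim by blast
  obtain B where B: "B \<subseteq> h" "independent B" "h \<subseteq> span B" "card B = dim h"
    using basis_exists by blast
  have "finite B" using independent_span_bound[OF C(1) B(2)] B(1) C(2) assms(2) by blast
  moreover have "span B = h" using span_minimal[OF B(1) assms(1)] B(3) by blast
  ultimately show "\<exists>B. finite B \<and> span B = h" by blast
qed (use assms in \<open>auto simp: subset_iff add_left add_right scale_left scale_right alternating jacobi\<close>)

section \<open>Splitting off a central line, semisimplicity of the kernel, and the contact
  form\<close>

theorem theorem3p1:
  fixes g :: "'a::real_vector set" and br :: "'a \<Rightarrow> 'a \<Rightarrow> 'a"
    and n :: nat and \<Omega> \<theta> :: "'a form"
  assumes "reductive g br"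
    and "lcs_structure g br n \<Omega> \<theta>"
    and "\<theta> \<noteq> 0"
  shows "semisimple (form_kernel g \<theta>) br \<and>
    (\<exists>\<eta> \<eta>' r.
       contact_form (form_kernel g \<theta>) br n \<eta> \<and>
       lie_direct_sum g br (form_kernel g \<theta>) r \<and> dim r = 1 \<and>
       extends_by_zero g (form_kernel g \<theta>) r \<eta> \<eta>' \<and>
       \<Omega> = ce_d g br \<eta>' - wedge \<theta> \<eta>') \<and>
    lcs_first_kind g br n \<Omega> \<theta>"
proof -
  have la: "lie_algebra g br" and n: "n \<ge> 2" and dim_g: "dim g = 2 * n"
    and \<Omega>: "\<Omega> \<in> forms g 2" and \<theta>: "\<theta> \<in> forms g 1" and vol: "wedge_power \<Omega> n \<noteq> 0"
    and d\<theta>: "ce_d g br \<theta> = 0" and d\<Omega>: "ce_d g br \<Omega> = wedge \<theta> \<Omega>"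
    using assms(2) by (auto simp: lcs_structure_def)
  interpret lie_algebra g br by (rule la)
  have hom\<Omega>: "homogeneous 2 \<Omega>" and hom\<theta>: "homogeneous 1 \<theta>"
    using forms_homogeneous \<Omega> \<theta> by blast+
  have lin\<Omega>: "multilinear_on g \<Omega>" and sk\<Omega>: "skew \<Omega>" and sup\<Omega>: "supported_on g \<Omega>"
    using forms_multilinear_on forms_skew forms_supported_on \<Omega> subspace by blast+
  define W where "W x y = \<Omega> [x, y]" for x y
  define t where "t x = \<theta> [x]" for x
  have W_left: "linear_on g (\<lambda>x. W x y)" if "y \<in> g" for y
    using multilinear_onD[OF lin\<Omega>, of "[]" "[y]" _ _ 1 1] multilinear_onD[OF lin\<Omega>, of "[]" "[y]" _ _ _ 0] that
    by (auto simp: linear_on_def W_def)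
  have W_right: "linear_on g (W x)" if "x \<in> g" for x
    using multilinear_onD[OF lin\<Omega>, of "[x]" "[]" _ _ 1 1] multilinear_onD[OF lin\<Omega>, of "[x]" "[]" _ _ _ 0] that
    by (auto simp: linear_on_def W_def)
  have W_skew: "W y x = - W x y" for x y
    using sk\<Omega> unfolding skew_def W_def by (metis append_Nil)
  have t_lin: "linear_on g t"
    using multilinear_onD[OF forms_multilinear_on[OF \<theta>], of "[]" "[]" _ _ 1 1]
      multilinear_onD[OF forms_multilinear_on[OF \<theta>], of "[]" "[]" _ _ _ 0]
    by (auto simp: linear_on_def t_def)
  have t_br: "t (br x y) = 0" if "x \<in> g" "y \<in> g" for x y
    using fun_cong[OF d\<theta>, of "[x, y]"] that by (simp add: ce_d_two t_def)
  have cocycle: "- W (br x y) z + W (br x z) y - W (br y z) x = t x * W y z - t y * W x z + t z * W x y"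
    if "x \<in> g" "y \<in> g" "z \<in> g" for x y z
    using fun_cong[OF d\<Omega>, of "[x, y, z]"] that
    by (simp add: ce_d_three wedge_one_three[OF hom\<theta>] W_def t_def)
  have vol_hom: "homogeneous (2 * n) (wedge_power \<Omega> n)"
    using wedge_power_homogeneous[OF hom\<Omega>, of n] by (simp add: mult.commute)
  note vol_props = wedge_power_skew[OF hom\<Omega> sk\<Omega>, of n] wedge_power_multilinear[OF hom\<Omega> lin\<Omega>, of n]
    wedge_power_supported_on[OF sup\<Omega>, of n]
  obtain m where m: "n = Suc m" using n by (cases n) auto
  \<comment> \<open>Completing \<open>x\<close> to a basis gives a nonzero value of the volume form
    with \<open>x\<close> in front, but that value is a multiple of a wedge product with
    \<open>ip x \<Omega> = 0\<close>.\<close>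
  have nondeg: "x = 0" if x: "x \<in> g" "\<And>y. y \<in> g \<Longrightarrow> W x y = 0" for x
  proof (rule ccontr)
    assume "x \<noteq> 0"
    then obtain B where B: "{x} \<subseteq> B" "B \<subseteq> g" "independent B" "g \<subseteq> span B"
      using maximal_independent_subset_extend[of "{x}" g] x(1) by auto
    have span_B: "span B = g" using span_minimal[OF B(2) subspace] B(4) by blast
    have card_B: "card B = 2 * n" using dim_unique[OF B(2,4,3) refl] dim_g by simp
    then have "finite B" using n card.infinite by fastforce
    then obtain vs where vs: "wedge_power \<Omega> n (x # vs) \<noteq> 0"
      using top_form_interior_nonzero[of B x "wedge_power \<Omega> n"] vol_hom vol_props vol card_B span_B B(1)
      by auto
    have "ip x \<Omega> us = 0" for us
    proof (cases "length us = 1 \<and> set us \<subseteq> g")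
      case True
      then obtain y where "us = [y]" "y \<in> g" by (cases us) auto
      then show ?thesis using x(2) by (simp add: interior_product_def W_def)
    next
      case False
      then have "length (x # us) \<noteq> 2 \<or> \<not> set (x # us) \<subseteq> g" by auto
      then show ?thesis
        using homogeneousD[OF hom\<Omega>] sup\<Omega> unfolding interior_product_def supported_on_def by blast
    qed
    then have "ip x \<Omega> = 0" by (simp add: fun_eq_iff)
    then have "wedge_power \<Omega> n (x # vs) = 0"
      using wedge_power_Suc_Cons[OF hom\<Omega>, of m x vs] by (simp add: m del: wedge_power.simps)
    with vs show False by simp
  qed
  define h where "h = form_kernel g \<theta>"
  have h_iff: "x \<in> h \<longleftrightarrow> x \<in> g \<and> t x = 0" for x by (auto simp: h_def form_kernel_def t_def)
  have hg: "h \<subseteq> g" using h_iff by blast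
  have h_sub: "subspace h"
    using subspace linear_on_zero[OF t_lin subspace] t_lin
    by (auto simp: subspace_def[of h] h_iff linear_on_add linear_on_scale
        subspace_0 subspace_add subspace_scale)
  have h_ideal: "lie_ideal g br h"
    using h_sub hg closed t_br by (auto simp: lie_ideal_def h_iff)
  have la_h: "lie_algebra h br"
    using lie_subalgebra[OF h_sub hg] closed t_br by (auto simp: h_iff)
  obtain r where r: "lie_direct_sum g br h r"
    using assms(1) h_ideal by (auto simp: reductive_def)
  have r_sub: "subspace r" and rg: "r \<subseteq> g" and hr: "h \<inter> r = {0}"
    using r by (auto simp: lie_direct_sum_def lie_ideal_def)
  \<comment> \<open>Only the \<open>r\<close> component of a vector contributes to \<open>t\<close>,
    so some vector of \<open>r\<close> has a nonzero value and can be normalised.\<close>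
  obtain T where T: "T \<in> r" "t T = 1"
  proof -
    obtain vs where vs: "\<theta> vs \<noteq> 0" using assms(3) by (auto simp: fun_eq_iff)
    then obtain x where x: "vs = [x]" using homogeneousD[OF hom\<theta>, of vs] by (cases vs) auto
    have "set vs \<subseteq> g" using vs forms_supported_on[OF \<theta>] unfolding supported_on_def by blast
    then have "x \<in> g" using x by simp
    then obtain y z where yz: "y \<in> h" "z \<in> r" "x = y + z" "y \<in> g" "z \<in> g"
      using lie_direct_sum_decompose[OF r] by metis
    then have "t x = t z" using linear_on_add[OF t_lin] by (simp add: h_iff)
    then have "t z \<noteq> 0" using vs x by (simp add: t_def)
    then have "t ((1 / t z) *\<^sub>R z) = 1" using yz linear_on_scale[OF t_lin] by simp
    then show ?thesis using that subspace_scale[OF r_sub yz(2)] by blast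
  qed
  have Tg: "T \<in> g" using T rg by blast
  have r_span: "r = span {T}"
  proof
    show "span {T} \<subseteq> r" using T r_sub by (intro span_minimal) auto
    \<comment> \<open>Subtracting the \<open>T\<close> component leaves a vector of \<open>r\<close>
      killed by \<open>t\<close>, thus in the trivial intersection of \<open>h\<close> and
      \<open>r\<close>.\<close>
    show "r \<subseteq> span {T}"
    proof
      fix x assume x: "x \<in> r"
      have "x - t x *\<^sub>R T \<in> r" using x T r_sub by (simp add: subspace_diff subspace_scale)
      moreover have "t (x - t x *\<^sub>R T) = 0"
        using x rg T Tg linear_on_diff[OF t_lin subspace, of x "t x *\<^sub>R T"] linear_on_scale[OF t_lin Tg] subspace
        by (auto simp: subspace_scale)
      ultimately have "x - t x *\<^sub>R T = 0" using hr rg h_iff by blast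
      then have "x = t x *\<^sub>R T" by simp
      then show "x \<in> span {T}" by (metis span_base span_scale singletonI)
    qed
  qed
  have dim_r: "dim r = 1"
  proof -
    have "T \<noteq> 0" using T(2) linear_on_zero[OF t_lin subspace] by auto
    then show ?thesis
      unfolding r_span by (subst dim_span_eq_card_independent) auto
  qed
  have T_central: "br T y = 0" if y: "y \<in> g" for y
  proof -
    obtain u v where uv: "u \<in> h" "v \<in> r" "y = u + v" "u \<in> g" "v \<in> g"
      using lie_direct_sum_decompose[OF r y] .
    obtain c where c: "v = c *\<^sub>R T" using uv(2) by (auto simp: r_span span_singleton)
    have "br u T = 0" using lie_direct_sum_commute[OF r uv(1) T(1)] .
    then have "br T u = 0" using bracket_skew[of u T] uv Tg by simp
    then show ?thesis using uv c Tg by (simp add: add_right scale_right alternating)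
  qed
  interpret L: reductive_lcs g br W t
  proof
    show "dim g > 2" using n dim_g by simp
    show "x = 0" if "x \<in> g" "\<And>y. y \<in> g \<Longrightarrow> W x y = 0" for x
      using nondeg that by blast
  qed (rule assms(1) W_left W_right W_skew t_lin cocycle; assumption)+
  \<comment> \<open>The equation \<open>cocycle\<close> at \<open>T\<close>, \<open>x\<close>,
    \<open>y\<close>, where \<open>T\<close> is central and \<open>t T = 1\<close>. The left-hand
    side is the differential of the one-form \<open>W _ T\<close>.\<close>
  have W_T: "- W (br x y) T = W x y - t x * W T y + t y * W T x" if "x \<in> g" "y \<in> g" for x y
  proof -
    have "W 0 z = 0" if "z \<in> g" for z using linear_on_zero[OF W_left subspace] that by blast
    then show ?thesis using cocycle[OF Tg that] T_central T that by simp
  qed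

  have "semisimple h br"
    unfolding semisimple_def
  proof (intro conjI la_h allI impI)
    fix a assume a: "lie_ideal h br a" "lie_solvable br a"
    have ah: "a \<subseteq> h" using a(1) by (simp add: lie_ideal_def)
    \<comment> \<open>An ideal of \<open>h\<close> is an ideal of \<open>g\<close>, since the
      missing direction \<open>T\<close> acts by zero.\<close>
    have "br x y \<in> a" if x: "x \<in> g" and y: "y \<in> a" for x y
    proof -
      obtain u v where uv: "u \<in> h" "v \<in> r" "x = u + v" "u \<in> g" "v \<in> g"
        using lie_direct_sum_decompose[OF r x] .
      obtain c where c: "v = c *\<^sub>R T" using uv(2) by (auto simp: r_span span_singleton)
      have yg: "y \<in> g" using y ah hg by blast
      have "br x y = br u y" using uv c Tg yg T_central by (simp add: add_left scale_left)
      then show ?thesis using a(1) uv y by (simp add: lie_ideal_def)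
    qed
    then have "lie_ideal g br a" using a(1) hg by (auto simp: lie_ideal_def)
    moreover obtain k where "(derived_algebra br ^^ k) a = {0}"
      using a(2) by (auto simp: lie_solvable_def)
    ultimately show "a = {0}"
      using L.solvable_ideal_in_lee_kernel_trivial[OF Tg T(2) T_central, of a k] ah h_iff by blast
  qed
  moreover
  \<comment> \<open>By skewness \<open>W x T\<close> is the value of \<open>- ip T \<Omega>\<close>
    at \<open>x\<close>. The forms on \<open>h\<close> and on \<open>g\<close> are distinct
    functions because each vanishes outside its own carrier.\<close>
  define \<eta> where "\<eta> = one_form h (\<lambda>x. W x T)"
  define \<eta>' where "\<eta>' = one_form g (\<lambda>x. W x T)"
  have "contact_form h br n \<eta>"
  proof -
    obtain B where B: "finite B" "independent B" "span B = h" "card B = dim h"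
      using lie_algebra.finite_basis[OF la_h] .
    have TB: "T \<notin> span B" using T(2) h_iff B(3) by simp
    then have TB': "T \<notin> B" using span_base by blast
    have indep: "independent (insert T B)" using independent_insertI[OF TB B(2)] .
    have span_TB: "span (insert T B) = g"
    proof
      show "span (insert T B) \<subseteq> g"
        using Tg B(3) hg span_superset[of B] subspace by (intro span_minimal) auto
      show "g \<subseteq> span (insert T B)"
      proof
        fix x assume "x \<in> g"
        then obtain u v where uv: "u \<in> h" "v \<in> r" "x = u + v"
          using lie_direct_sum_decompose[OF r] by metis
        have "u \<in> span (insert T B)" using uv(1) B(3) span_mono[of B "insert T B"] by blast
        moreover have "v \<in> span (insert T B)" using uv(2) r_span span_mono[of "{T}" "insert T B"] by blast
        ultimately show "x \<in> span (insert T B)" using uv(3) span_add by blast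
      qed
    qed
    have "dim g = card (insert T B)"
      using dim_span_eq_card_independent[OF indep] span_TB by simp
    then have card_TB: "card (insert T B) = 2 * n" using dim_g by simp
    then have dim_h: "dim h = 2 * n - 1" using B TB' by simp
    \<comment> \<open>With \<open>T\<close> in front, the remaining arguments come from the basis
      \<open>B\<close> of \<open>h\<close>.\<close>
    obtain vs where vs: "set vs \<subseteq> insert T B - {T}" "wedge_power \<Omega> n (T # vs) \<noteq> 0"
      using top_form_interior_nonzero[of "insert T B" T "wedge_power \<Omega> n"]
        vol_hom vol_props vol card_TB span_TB B(1) by auto
    have vs_h: "set vs \<subseteq> h" using vs(1) B(3) span_superset[of B] by blast
    have \<eta>_eq: "\<eta> us = - ip T \<Omega> us" if "set us \<subseteq> h" for us
    proof (cases "length us = 1")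
      case True
      then obtain x where "us = [x]" by (cases us) auto
      then show ?thesis
        using that W_skew[of x T] by (simp add: \<eta>_def interior_product_def W_def)
    next
      case False
      then show ?thesis
        using homogeneousD[OF one_form_homogeneous] homogeneousD[OF hom\<Omega>]
        by (simp add: \<eta>_def interior_product_def)
    qed
    \<comment> \<open>The \<open>t\<close> terms of \<open>W_T\<close> vanish on \<open>h\<close>,
      so there the differential of \<open>\<eta>\<close> is \<open>\<Omega>\<close> itself.\<close>
    have d\<eta>_eq: "ce_d h br \<eta> us = \<Omega> us" if us: "set us \<subseteq> h" for us
    proof (cases "length us = 2")
      case True
      then obtain x y where xy: "us = [x, y]" by (auto simp: numeral_2_eq_2 length_Suc_conv)
      then have "x \<in> h" "y \<in> h" using us by auto
      moreover have "br x y \<in> h" using lie_algebra.closed[OF la_h] calculation by blast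
      ultimately show ?thesis
        using W_T[of x y] by (simp add: xy ce_d_two \<eta>_def h_iff) (simp add: W_def)
    next
      case False
      have "homogeneous 2 (ce_d h br \<eta>)"
        using ce_d_homogeneous[OF one_form_homogeneous] by (simp add: \<eta>_def numeral_2_eq_2)
      then show ?thesis
        using False homogeneousD[OF hom\<Omega>] homogeneousD[of 2 "ce_d h br \<eta>"] by simp
    qed
    have "wedge \<eta> (wedge_power (ce_d h br \<eta>) m) vs = wedge (\<lambda>us. - ip T \<Omega> us) (wedge_power \<Omega> m) vs"
    proof (rule wedge_cong)
      show "\<eta> us = - ip T \<Omega> us" if "set us \<subseteq> set vs" for us
        using \<eta>_eq that vs_h by blast
      show "wedge_power (ce_d h br \<eta>) m us = wedge_power \<Omega> m us" if "set us \<subseteq> set vs" for us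
        using d\<eta>_eq that vs_h by (intro wedge_power_cong) blast
    qed
    \<comment> \<open>Up to the factor \<open>- n\<close>, this is the nonzero value of the volume
      form at \<open>T # vs\<close>.\<close>
    also have "\<dots> \<noteq> 0"
      using vs(2) wedge_power_Suc_Cons[OF hom\<Omega>, of m T vs]
      by (simp add: m wedge_minus_left del: wedge_power.simps)
    finally have "wedge \<eta> (wedge_power (ce_d h br \<eta>) (n - 1)) \<noteq> 0"
      by (auto simp: m fun_eq_iff)
    moreover have "linear_on h (\<lambda>x. W x T)"
      using W_left[OF Tg] hg unfolding linear_on_def by blast
    then have "\<eta> \<in> forms h 1"
      unfolding \<eta>_def using one_form_in_forms[OF h_sub] by blast
    ultimately show ?thesis
      using la_h n dim_h by (simp add: contact_form_def)
  qed
  moreover have "extends_by_zero g h r \<eta> \<eta>'"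
  proof -
    have "W x T = 0" if x: "x \<in> r" for x
    proof -
      obtain c where c: "x = c *\<^sub>R T" using x by (auto simp: r_span span_singleton)
      have "W T T = 0" using W_skew[of T T] by simp
      then show ?thesis using c linear_on_scale[OF W_left[OF Tg] Tg] by simp
    qed
    then show ?thesis
      using hg rg one_form_in_forms[OF subspace W_left[OF Tg]]
      by (auto simp: extends_by_zero_def \<eta>_def \<eta>'_def)
  qed
  moreover have "\<Omega> = ce_d g br \<eta>' - wedge \<theta> \<eta>'"
  proof
    fix vs
    have hom': "homogeneous 1 \<eta>'" by (simp add: \<eta>'_def one_form_homogeneous del: One_nat_def)
    show "\<Omega> vs = (ce_d g br \<eta>' - wedge \<theta> \<eta>') vs"
    proof (cases "length vs = 2")
      case False
      have "homogeneous 2 (ce_d g br \<eta>')" "homogeneous 2 (wedge \<theta> \<eta>')"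
        using ce_d_homogeneous[OF hom'] homogeneous_wedge[OF hom\<theta> hom'] by (simp_all add: numeral_2_eq_2)
      then show ?thesis using False hom\<Omega> by (simp add: homogeneousD)
    next
      case True
      then obtain x y where xy: "vs = [x, y]" by (auto simp: numeral_2_eq_2 length_Suc_conv)
      show ?thesis
      proof (cases "x \<in> g \<and> y \<in> g")
        case True
        then show ?thesis
          using W_T[of x y] closed[of x y] W_skew[of T x] W_skew[of T y]
          by (simp add: xy ce_d_two wedge_one_two[OF hom\<theta> hom']) (simp add: \<eta>'_def W_def t_def)
      next
        case False
        then have "\<not> set vs \<subseteq> g" by (auto simp: xy)
        then have "\<Omega> vs = 0" using sup\<Omega> unfolding supported_on_def by blast
        moreover have "\<theta> [z] = 0" "\<eta>' [z] = 0" if "z \<notin> g" for z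
          using forms_supported_on[OF \<theta>, unfolded supported_on_def, rule_format, of "[z]"] that
          by (auto simp: \<eta>'_def)
        ultimately show ?thesis
          using False by (auto simp: xy ce_d_two wedge_one_two[OF hom\<theta> hom'])
      qed
    qed
  qed
  \<comment> \<open>On \<open>x\<close>, \<open>y\<close> in \<open>g\<close>, centrality of
    \<open>T\<close> reduces the first summand to \<open>- W (br x y) T\<close> and the second is
    \<open>- W T (br x y)\<close>; they cancel by skewness.\<close>
  moreover have "lie_derivative g br T \<Omega> = 0"
  proof
    fix vs
    show "lie_derivative g br T \<Omega> vs = 0 vs"
    proof (cases "length vs = 2 \<and> set vs \<subseteq> g")
      case True
      then obtain x y where xy: "vs = [x, y]" "x \<in> g" "y \<in> g"
        by (auto simp: numeral_2_eq_2 length_Suc_conv)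
      have "W 0 z = 0" if "z \<in> g" for z using linear_on_zero[OF W_left subspace] that by blast
      then show ?thesis
        using xy Tg T_central W_skew[of T "br x y"]
        by (simp add: lie_derivative_def interior_product_def ce_d_three ce_d_two W_def)
    next
      case False
      have "homogeneous 3 (ce_d g br \<Omega>)" "homogeneous 2 (ce_d g br (ip T \<Omega>))"
        using ce_d_homogeneous[OF hom\<Omega>, of g br] ce_d_homogeneous[OF homogeneous_interior[of 1 \<Omega> T], of g br] hom\<Omega>
        by (simp_all add: numeral_2_eq_2 numeral_3_eq_3)
      moreover have "length vs \<noteq> 2 \<and> length (T # vs) \<noteq> 3 \<or> \<not> set vs \<subseteq> g \<and> \<not> set (T # vs) \<subseteq> g"
        using False by auto
      ultimately have "ce_d g br \<Omega> (T # vs) = 0" "ce_d g br (ip T \<Omega>) vs = 0"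
        using homogeneousD ce_d_supported_on[of g br] unfolding supported_on_def by blast+
      then show ?thesis
        by (simp add: lie_derivative_def interior_product_def[of T "ce_d g br \<Omega>"])
    qed
  qed
  then have "lcs_first_kind g br n \<Omega> \<theta>"
    using assms(2) Tg T(2) by (auto simp: lcs_first_kind_def t_def)
  ultimately show ?thesis
    using r dim_r unfolding h_def by blast
qed

end
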